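(* Let $d\ge 1$ be an integer, let $a>0$ be a real number, and let $(X_n)_{n\ge 0}$ be the once-reinforced random walk with reinforcement parameter $a$ on the tree $\mathbb{T}_d$, started at the root $\emptyset$. Then: (i) if $a>\log_2(d)$, the walk is almost surely recurrent; (ii) if $0<a<\log_2(d)$, the walk is almost surely transient.
   Context: The tree $\mathbb{T}_d$. For an integer $d\ge 1$, $\mathbb{T}_d$ is the infinite tree rooted at a vertex $\emptyset$ defined as follows. The level of a vertex is its graph distance to the root, so $\emptyset$ is at level $0$. The root has exactly one child (at level $1$). Each vertex at a level of the form $2^k$ with $k\ge 0$ an integer (i.e. levels $1,2,4,8,\dots$) has exactly $d$ children. Every vertex at any other level has exactly one child. Write $x\sim y$ if $x$ and $y$ are neighbours in $\mathbb{T}_d$ (one is a child of the other), and $[x,y]$ for the non-oriented edge joining them. Once-reinforced random walk (ORRW) with parameter $a>0$. It is the nearest-neighbour process $(X_n)_{n\ge 0}$ on the vertices of $\mathbb{T}_d$, with $X_0=\emptyset$ and natural filtration $\mathcal{F}_n=\sigma(X_0,\dots,X_n)$, whose law is determined as follows. For $n\ge 0$ let $$E_n=\left\{[x,y]:\ x,y\in\mathbb{T}_d \text{ and there exists } 1\le k\le n \text{ such that } \{X_{k-1},X_k\}=\{x,y\}\right\}$$ be the set of non-oriented edges crossed up to time $n$. On the event $X_n=x$, for each neighbour $y\sim x$, $$\mathbb{P}\left[X_{n+1}=y\mid\mathcal{F}_n\right]=\frac{(a-1)\mathbf{1}\{[x,y]\in E_n\}+1}{\sum_{z:\,z\sim x}\left((a-1)\mathbf{1}\{[x,z]\in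 E_n\}+1\right)}.$$ That is, at each time an edge has weight $1$ if it has never been crossed (in either direction) and weight $a$ otherwise, and the walk crosses an adjacent edge with probability proportional to its current weight. All values $a>0$ are allowed, including $a\le 1$. Recurrence and transience. The walk is almost surely recurrent if, with probability $1$, it visits the root $\emptyset$ infinitely many times. It is almost surely transient if, with probability $1$, it visits every vertex only finitely many times. *)

theory Defs
  imports "HOL-Probability.Probability"
begin

text \<open>
  A vertex is the list of birth ranks along the path leading to it from the root, most recent
  first, so the root is \<^term>\<open>[]\<close>, the children of \<open>v\<close> are the lists \<open>i # v\<close>, and the level of
  \<open>v\<close> (its distance to the root) is \<^term>\<open>length v\<close>.
\<close>

definition num_children :: "nat \<Rightarrow> nat \<Rightarrow> nat" where
  "num_children d l = (if \<exists>k. l = 2 ^ k then d else 1)"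

inductive_set tree :: "nat \<Rightarrow> nat list set" for d :: nat where
  root: "[] \<in> tree d"
| child: "v \<in> tree d \<Longrightarrow> i < num_children d (length v) \<Longrightarrow> i # v \<in> tree d"

definition adj :: "nat \<Rightarrow> nat list \<Rightarrow> nat list \<Rightarrow> bool" where
  "adj d x y \<longleftrightarrow> x \<in> tree d \<and> y \<in> tree d \<and> (\<exists>i. x = i # y \<or> y = i # x)"

text \<open>The next lemma ensures that the normalising sum in \<open>orrw\<close> below is a genuine finite sum.\<close>

lemma finite_neighbours: "finite {z. adj d x z}"
proof -
  have "{z. adj d x z} \<subseteq> insert (tl x) ((\<lambda>i. i # x) ` {..<num_children d (length x)})"
    by (auto simp: adj_def elim: tree.cases)
  then show ?thesis
    by (rule finite_subset) simp
qed

definition crossed :: "(nat \<Rightarrow> 'v) \<Rightarrow> nat \<Rightarrow> 'v set set" where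
  "crossed w n = {{w (k - 1), w k} | k. 1 \<le> k \<and> k \<le> n}"

definition edge_weight :: "real \<Rightarrow> 'v set set \<Rightarrow> 'v set \<Rightarrow> real" where
  "edge_weight a E e = (a - 1) * indicator E e + 1"

definition natural_filtration :: "'w measure \<Rightarrow> (nat \<Rightarrow> 'w \<Rightarrow> 'v) \<Rightarrow> nat \<Rightarrow> 'w measure" where
  "natural_filtration M X n = sigma (space M) {X k -` A \<inter> space M | k A. k \<le> n}"

locale orrw = prob_space M
  for d :: nat and a :: real and M :: "'w measure" and X :: "nat \<Rightarrow> 'w \<Rightarrow> nat list" +
  assumes measurable_X: "X n \<in> measurable M (count_space (tree d))"
    and start: "AE \<omega> in M. X 0 \<omega> = []"
    and nearest_neighbour: "AE \<omega> in M. adj d (X n \<omega>) (X (Suc n) \<omega>)"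
    and transition: "adj d x y \<Longrightarrow>
      AE \<omega> in M. X n \<omega> = x \<longrightarrow>
        real_cond_exp M (natural_filtration M X n)
            (indicator {\<omega>' \<in> space M. X (Suc n) \<omega>' = y}) \<omega> =
          edge_weight a (crossed (\<lambda>k. X k \<omega>) n) {x, y} /
          (\<Sum>z | adj d x z. edge_weight a (crossed (\<lambda>k. X k \<omega>) n) {x, z})"

text \<open>
  The natural filtration consists of sub-sigma-algebras of \<open>M\<close>. This matters because
  \<^const>\<open>real_cond_exp\<close> is identically zero otherwise.
\<close>

lemma (in orrw) subalgebra_natural_filtration: "subalgebra M (natural_filtration M X n)"
proof -
  have "X k -` A \<inter> space M \<in> sets M" for k A
  proof -
    have "X k -` A \<inter> space M = X k -` (A \<inter> tree d) \<inter> space M"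
      using measurable_space[OF measurable_X] by auto
    then show ?thesis
      using measurable_sets[OF measurable_X, of "A \<inter> tree d" k] by simp
  qed
  then have "sigma_sets (space M) {X k -` A \<inter> space M | k A. k \<le> n} \<subseteq> sets M"
    by (intro sets.sigma_sets_subset) auto
  moreover have "{X k -` A \<inter> space M | k A. k \<le> n} \<subseteq> Pow (space M)"
    by auto
  ultimately show ?thesis
    by (simp add: subalgebra_def natural_filtration_def space_measure_of sets_measure_of)
qed

definition as_recurrent :: "'w measure \<Rightarrow> (nat \<Rightarrow> 'w \<Rightarrow> nat list) \<Rightarrow> bool" where
  "as_recurrent M X \<longleftrightarrow> (AE \<omega> in M. infinite {n. X n \<omega> = []})"

definition as_transient :: "nat \<Rightarrow> 'w measure \<Rightarrow> (nat \<Rightarrow> 'w \<Rightarrow> nat list) \<Rightarrow> bool" where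
  "as_transient d M X \<longleftrightarrow> (AE \<omega> in M. \<forall>v \<in> tree d. finite {n. X n \<omega> = v})"

end

(*
  For a vertex x at level N, let J be the level at which the walk's position branches off the
  geodesic to x, and m the deepest level of that geodesic visited so far. Writing
  P m = (1 + a/1) ... (1 + a/(m-1)), which is of order m powr a, the quantity (J/m) * P m / P N is
  exactly the conditional probability of reaching x before the root in the walk observed on the
  geodesic only; off the root it is a martingale for the walk on the whole tree. Summing over the
  d^k vertices of level N = 2^k bounds the probability of reaching level N before the root by
  O((d / 2 powr a)^k), which gives recurrence for a > log 2 d.

  For a < log 2 d the same functions, averaged over the level-N descendants of a vertex f of level
  2^k + 1, form a martingale W, killed on returning to the parent of f. Its square is dominated by
  an explicit second martingale G (a two-point analogue of the functions above), whose initial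
  value C * (2 powr a)^k is bounded in N. As 2*e*W - e^2*G is at most 1 and vanishes on return, with
  e = 1 / (C * (2 powr a)^k) the first excursion into the subtree of f never returns with
  probability at least e. On recurrence all d^(k+1) such subtrees are visited and left, which has
  probability at most (1 - e)^(d^(k+1)); this tends to 0 as k grows.
*)
theory Submission
  imports Defs "HOL-Library.Sublist"
begin

text \<open>Seen on one geodesic with its first m edges crossed, the walk has edges of weight a
  behind it and a fresh edge of weight 1 ahead. From level m it takes the fresh edge before meeting
  the root with probability m / (m + a), since the way back has conductance a / m; from level J it
  gets to level m first with probability J / m. This is the source of P and of the factor J / m. The
  obstacle to transience is that different geodesics share their past up to the branching point, so
  survival along them is not independent. A second moment argument replaces independence: over all
  e, the largest value of 2*e*W - e^2*G is W^2 / G. At the first visit to f one has W = 1, and the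
  chosen e is a lower bound for 1 / G that holds for every past of the walk. This uniformity allows
  the d^(k+1) dependent attempts to be multiplied. All these functions depend on a finite history
  only, so one-step means \<open>step\<close> and a single optional stopping inequality,
  \<open>prob_hit\<close>, are enough.\<close>

section \<open>Geodesics in the tree\<close>


text \<open>The level at which the geodesics from the root to \<open>p\<close> and to
  \<open>x\<close> separate, found by climbing from \<open>p\<close> until an ancestor of
  \<open>x\<close> appears. Suffixes are ancestors because the newest birth rank stands
  first.\<close>

primrec meet :: "'b list \<Rightarrow> 'b list \<Rightarrow> nat" where
  "meet x [] = 0"
| "meet x (i # p) = (if suffix (i # p) x then Suc (length p) else meet x p)"

lemma length_le_meet_iff: "suffix q x \<Longrightarrow> length q \<le> meet x v \<longleftrightarrow> suffix q v"
proof (induction v)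
  case (Cons i v)
  show ?case
  proof (cases "suffix (i # v) x")
    case True
    then show ?thesis
      using Cons.prems by (auto intro: suffix_length_suffix dest: suffix_length_le)
  next
    case False
    then have "q \<noteq> i # v" using Cons.prems by auto
    then show ?thesis using Cons False by (auto simp: suffix_Cons)
  qed
qed auto

lemma meet_eq_length: "suffix p x \<Longrightarrow> meet x p = length p"
  by (cases p) auto

lemma meet_le: "meet x p \<le> length p"
  by (induction p) auto

lemma meet_witness: "\<exists>z. suffix z x \<and> suffix z p \<and> length z = meet x p"
proof (induction p)
  case Nil
  then show ?case by (intro exI[of _ "[]"]) auto
next
  case (Cons i p)
  then show ?case by (cases "suffix (i # p) x") (auto simp: suffix_Cons)
qed

lemma meet_commute: "meet x y = meet y x"
proof -
  have "meet x y \<le> meet y x" for x y :: "'a list"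
    using meet_witness[of x y] length_le_meet_iff by metis
  then show ?thesis by (metis le_antisym)
qed

lemma meet_le': "meet x p \<le> length x"
  by (metis meet_commute meet_le)

lemma meet_ultrametric: "min (meet x v) (meet y v) \<le> meet x y"
proof -
  obtain z1 z2 where z: "suffix z1 x" "suffix z1 v" "length z1 = meet x v"
    "suffix z2 y" "suffix z2 v" "length z2 = meet y v"
    using meet_witness by metis
  show ?thesis
  proof (cases "length z1 \<le> length z2")
    case True
    then have "suffix z1 z2" using z suffix_length_suffix by blast
    then have "suffix z1 y" using z suffix_order.trans by blast
    then show ?thesis using z length_le_meet_iff[of z1 x y] by auto
  next
    case False
    then have "suffix z2 z1" using z suffix_length_suffix[of z2 v z1] by auto
    then have "suffix z2 x" using z suffix_order.trans by blast
    then show ?thesis using z length_le_meet_iff[of z2 y x] by (auto simp: meet_commute[of x y])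
  qed
qed

lemma meet_eq_below_branching:
  assumes "meet x v < meet x y" shows "meet y v = meet x v"
  using assms meet_ultrametric[of x v y] meet_ultrametric[of x y v] meet_ultrametric[of y x v]
  by (auto simp: meet_commute[of y x] meet_commute[of v] min_def split: if_splits)

text \<open>\<open>p\<close> lies on the geodesic to \<open>x\<close>, at or beyond the point where
  \<open>y\<close> leaves it, so \<open>y\<close> branches off from \<open>p\<close> where it
  branches off from \<open>x\<close>.\<close>

lemma meet_off_branch:
  assumes "suffix (i # p) x" "\<not> suffix (i # p) y"
  shows "meet y p = meet x y" and "meet x y \<le> length p"
proof -
  have p: "suffix p x" using assms(1) suffix_ConsD by metis
  have le: "meet x y \<le> length p"
    using length_le_meet_iff[OF assms(1), of y] assms(2) by auto
  then show "meet x y \<le> length p" .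
  have "min (meet x p) (meet y p) \<le> meet x y" by (rule meet_ultrametric)
  moreover have "min (meet y x) (meet p x) \<le> meet y p" by (rule meet_ultrametric)
  ultimately show "meet y p = meet x y"
    using le meet_le[of y p] meet_eq_length[OF p]
    by (auto simp: meet_commute[of y x] meet_commute[of p x])
qed

text \<open>For a set closed under ancestors, such as the vertices visited by a walk, this is the
  deepest level of the geodesic to \<open>x\<close> that belongs to the set.\<close>

definition depth :: "'b list \<Rightarrow> 'b list set \<Rightarrow> nat" where
  "depth x V = Max (meet x ` V)"

lemma meet_le_depth: "finite V \<Longrightarrow> v \<in> V \<Longrightarrow> meet x v \<le> depth x V"
  unfolding depth_def by auto

lemma depth_le: "finite V \<Longrightarrow> V \<noteq> {} \<Longrightarrow> (\<And>v. v \<in> V \<Longrightarrow> meet x v \<le> n) \<Longrightarrow> depth x V \<le> n"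
  unfolding depth_def by auto

lemma depth_insert:
  "finite V \<Longrightarrow> V \<noteq> {} \<Longrightarrow> depth x (insert q V) = max (meet x q) (depth x V)"
  unfolding depth_def by simp

lemma depth_eq_below_branching:
  assumes "finite V" "V \<noteq> {}" "depth x V < meet x y"
  shows "depth y V = depth x V"
proof -
  have "meet y v = meet x v" if "v \<in> V" for v
    by (rule meet_eq_below_branching) (use meet_le_depth[OF assms(1) that, of x] assms(3) in simp)
  then show ?thesis unfolding depth_def by (metis (mono_tags, lifting) image_cong)
qed

text \<open>Closure under ancestors makes the missing child \<open>i # p\<close> a barrier: nothing
  at or beyond it on the geodesic to \<open>x\<close> can be in \<open>V\<close>.\<close>

lemma depth_unvisited:
  assumes "finite V" "p \<in> V" "\<And>u v. v \<in> V \<Longrightarrow> suffix u v \<Longrightarrow> u \<in> V"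
    and "suffix (i # p) x" "i # p \<notin> V"
  shows "depth x V = length p"
proof (rule antisym)
  show "depth x V \<le> length p"
  proof (rule depth_le)
    fix v assume "v \<in> V"
    then show "meet x v \<le> length p"
      using length_le_meet_iff[OF assms(4), of v] assms(3)[of v "i # p"] assms(5) by fastforce
  qed (use assms in auto)
  show "length p \<le> depth x V"
    using meet_le_depth[OF assms(1,2), of x] meet_eq_length[of p x] suffix_ConsD[OF assms(4)] by simp
qed

lemma tree_suffix: "v \<in> tree d \<Longrightarrow> suffix u v \<Longrightarrow> u \<in> tree d"
  by (induction arbitrary: u rule: tree.induct) (auto simp: suffix_Cons intro: tree.intros)

lemma tree_Cons_iff: "i # v \<in> tree d \<longleftrightarrow> v \<in> tree d \<and> i < num_children d (length v)"
  by (auto intro: tree.intros elim: tree.cases)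

lemma neighbours_eq:
  assumes "p \<in> tree d" "p \<noteq> []"
  shows "{q. adj d p q} = insert (tl p) ((\<lambda>i. i # p) ` {..<num_children d (length p)})"
proof -
  have "tl p \<in> tree d" using assms tree_suffix suffix_tl by blast
  then show ?thesis using assms
    by (auto simp: adj_def tree_Cons_iff intro: exI[of _ "hd p"])
qed

text \<open>Off the geodesic to \<open>x\<close> no neighbour changes the branching level. On it the
  parent lowers the level by one, the single child towards \<open>x\<close> raises it by one, and
  the other children keep it.\<close>

lemma sum_meet_neighbours:
  assumes "p \<in> tree d" "p \<noteq> []" "x \<in> tree d" "p \<noteq> x"
  shows "(\<Sum>q | adj d p q. real (meet x q) - real (meet x p)) = 0"
proof -
  let ?n = "num_children d (length p)"
  obtain i0 p0 where p: "p = i0 # p0" using assms(2) by (cases p) auto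
  have up: "real (meet x (i # p)) - real (meet x p) = of_bool (suffix (i # p) x)" for i
    using meet_eq_length[OF suffix_ConsD[of i p x]] by auto
  have down: "real (meet x (tl p)) - real (meet x p) = - of_bool (suffix p x)"
    using meet_eq_length[of p0 x] suffix_ConsD[of i0 p0 x] by (auto simp: p)
  have "(\<Sum>q | adj d p q. real (meet x q) - real (meet x p)) =
    (real (meet x (tl p)) - real (meet x p)) +
    (\<Sum>q \<in> (\<lambda>i. i # p) ` {..<?n}. real (meet x q) - real (meet x p))"
    unfolding neighbours_eq[OF assms(1,2)] by (rule sum.insert) (auto simp: p)
  also have "(\<Sum>q \<in> (\<lambda>i. i # p) ` {..<?n}. real (meet x q) - real (meet x p)) =
    (\<Sum>i<?n. of_bool (suffix (i # p) x))"
    by (subst sum.reindex) (auto simp: inj_on_def up simp del: meet.simps)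
  also have "(\<Sum>i<?n. of_bool (suffix (i # p) x)) = (of_bool (suffix p x) :: real)"
  proof (cases "suffix p x")
    case True
    then obtain zs where zs: "x = zs @ p" by (auto simp: suffix_def)
    then have "zs \<noteq> []" using assms(4) by auto
    then obtain us j where us: "zs = us @ [j]" by (metis rev_exhaust)
    have iff: "suffix (i # p) x \<longleftrightarrow> i = j" for i
    proof
      assume "suffix (i # p) x"
      moreover have "suffix (j # p) x" by (auto simp: zs us suffix_def)
      ultimately have "suffix (i # p) (j # p)" by (metis suffix_length_suffix length_Cons le_refl)
      then show "i = j" by (simp add: suffix_def Cons_eq_append_conv)
    qed (auto simp: zs us suffix_def)
    then have "j # p \<in> tree d" using assms(3) tree_suffix by blast
    then have "j < ?n" by (simp add: tree_Cons_iff)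
    then show ?thesis using True by (simp add: iff of_bool_def)
  next
    case False
    then show ?thesis using suffix_ConsD by fastforce
  qed
  finally show ?thesis using down by simp
qed

section \<open>Finite histories of the walk\<close>

text \<open>Histories are listed most recent position first, so \<^term>\<open>hd h\<close> is the current position.\<close>

inductive walk :: "nat \<Rightarrow> nat list list \<Rightarrow> bool" for d where
  walk_start: "walk d [[]]"
| walk_step: "walk d h \<Longrightarrow> adj d (hd h) q \<Longrightarrow> walk d (q # h)"

lemma walk_not_Nil: "walk d h \<Longrightarrow> h \<noteq> []"
  by (induction rule: walk.induct) auto

lemma walk_subset_tree: "walk d h \<Longrightarrow> set h \<subseteq> tree d"
  by (induction rule: walk.induct) (auto simp: adj_def intro: tree.intros)

text \<open>A step leads either to a child of a visited vertex or to the parent of one, and that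
  parent is visited already by induction.\<close>

lemma walk_suffix_closed: "walk d h \<Longrightarrow> v \<in> set h \<Longrightarrow> suffix u v \<Longrightarrow> u \<in> set h"
proof (induction arbitrary: u v rule: walk.induct)
  case walk_start
  then show ?case by auto
next
  case (walk_step h q)
  have hd: "hd h \<in> set h" using walk_step.hyps(1) walk_not_Nil by auto
  from walk_step.hyps(2) consider i where "q = i # hd h" | i where "hd h = i # q"
    by (auto simp: adj_def)
  then show ?case
  proof cases
    case 1
    then show ?thesis using walk_step hd by (auto simp: suffix_Cons)
  next
    case 2
    then have "q \<in> set h" using walk_step.IH[OF hd] by (auto simp: suffix_Cons)
    then show ?thesis using walk_step by auto
  qed
qed

lemma walk_length_le: "walk d h \<Longrightarrow> v \<in> set h \<Longrightarrow> length v < length h"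
proof (induction arbitrary: v rule: walk.induct)
  case (walk_step h q)
  have "hd h \<in> set h" using walk_step.hyps(1) walk_not_Nil by auto
  then have "length (hd h) < length h" using walk_step.IH by auto
  then have "length q < Suc (length h)" using walk_step.hyps(2) by (auto simp: adj_def)
  then show ?case using walk_step by (auto intro: less_SucI)
qed auto

lemma finite_walks: "finite {h. walk d h \<and> length h = Suc n}"
proof (induction n)
  case 0
  have "{h. walk d h \<and> length h = Suc 0} \<subseteq> {[[]]}"
  proof
    fix h assume h: "h \<in> {h. walk d h \<and> length h = Suc 0}"
    then have "walk d h" by simp
    then show "h \<in> {[[]]}" using h by cases (auto dest: walk_not_Nil)
  qed
  then show ?case by (rule finite_subset) auto
next
  case (Suc n)
  let ?S = "{h. walk d h \<and> length h = Suc n}"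
  have "{h. walk d h \<and> length h = Suc (Suc n)} \<subseteq> (\<Union>h\<in>?S. (\<lambda>q. q # h) ` {q. adj d (hd h) q})"
  proof
    fix h assume h: "h \<in> {h. walk d h \<and> length h = Suc (Suc n)}"
    then have "walk d h" by simp
    then show "h \<in> (\<Union>h\<in>?S. (\<lambda>q. q # h) ` {q. adj d (hd h) q})"
      using h by cases auto
  qed
  then show ?case by (rule finite_subset) (use Suc finite_neighbours in auto)
qed

section \<open>Counting descendants at dyadic levels\<close>

definition descendants :: "nat \<Rightarrow> nat list \<Rightarrow> nat \<Rightarrow> nat list set" where
  "descendants d z n = {x \<in> tree d. suffix z x \<and> length x = n}"

lemma card_descendants:
  assumes "z \<in> tree d"
  shows "finite (descendants d z (length z + n)) \<and>
    card (descendants d z (length z + n)) = (\<Prod>i=length z..<length z + n. num_children d i)"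
proof (induction n)
  case 0
  have "descendants d z (length z) = {z}"
    using assms by (auto simp: descendants_def suffix_def)
  then show ?case by simp
next
  case (Suc n)
  let ?m = "length z + n"
  have eq: "descendants d z (Suc ?m) =
    (\<lambda>(x, i). i # x) ` (descendants d z ?m \<times> {..<num_children d ?m})"
  proof (intro set_eqI iffI)
    fix x assume x: "x \<in> descendants d z (Suc ?m)"
    then obtain i y where xi: "x = i # y" by (cases x) (auto simp: descendants_def)
    have "suffix z y" using x unfolding xi by (auto simp: descendants_def suffix_Cons)
    then show "x \<in> (\<lambda>(x, i). i # x) ` (descendants d z ?m \<times> {..<num_children d ?m})"
      using x unfolding xi by (force simp: descendants_def tree_Cons_iff)
  qed (auto simp: descendants_def tree_Cons_iff suffix_Cons)
  have "inj_on (\<lambda>(x :: nat list, i :: nat). i # x) S" for S by (auto simp: inj_on_def)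
  then have "card (descendants d z (Suc ?m)) = card (descendants d z ?m) * num_children d ?m"
    unfolding eq by (subst card_image) (auto simp: card_cartesian_product)
  then show ?case using Suc eq by auto
qed

text \<open>Each doubling of the level passes exactly one branching level, the power of two at its
  lower end, and so contributes one factor \<open>d\<close>.\<close>

lemma prod_num_children_dyadic:
  "(\<Prod>i=2 ^ k..<2 ^ (k + j). num_children d i) = d ^ j"
proof (induction j)
  case (Suc j)
  let ?n = "2 ^ (k + j) :: nat"
  have 1: "num_children d i = 1" if "i \<in> {Suc ?n..<2 * ?n}" for i
  proof -
    have "i \<noteq> 2 ^ e" for e
    proof
      assume i: "i = 2 ^ e"
      then have lt: "2 ^ (k + j) < (2 :: nat) ^ e" "(2 :: nat) ^ e < 2 ^ Suc (k + j)"
        using that by (simp_all add: Suc_le_eq)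
      have "k + j < e" using lt(1) by (rule power_less_imp_less_exp[rotated]) simp
      moreover have "e < Suc (k + j)" using lt(2) by (rule power_less_imp_less_exp[rotated]) simp
      ultimately show False by simp
    qed
    then show ?thesis by (auto simp: num_children_def)
  qed
  have "(\<Prod>i=?n..<2 * ?n. num_children d i) =
    num_children d ?n * (\<Prod>i=Suc ?n..<2 * ?n. num_children d i)"
    by (rule prod.atLeast_Suc_lessThan) simp
  also have "(\<Prod>i=Suc ?n..<2 * ?n. num_children d i) = 1" using 1 by (intro prod.neutral) auto
  finally have 2: "(\<Prod>i=?n..<2 * ?n. num_children d i) = d" by (auto simp: num_children_def)
  have "(\<Prod>i=2 ^ k..<2 ^ (k + Suc j). num_children d i) =
    (\<Prod>i=2 ^ k..<?n. num_children d i) * (\<Prod>i=?n..<2 * ?n. num_children d i)"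
    using prod.atLeastLessThan_concat[of "2 ^ k" ?n "2 * ?n" "num_children d"] by simp
  then show ?case using Suc 2 by simp
qed auto

lemma finite_descendants: "z \<in> tree d \<Longrightarrow> finite (descendants d z n)"
proof (cases "length z \<le> n")
  case True
  then show "z \<in> tree d \<Longrightarrow> ?thesis" using card_descendants[of z d "n - length z"] by simp
next
  case False
  then have "descendants d z n = {}" by (auto simp: descendants_def dest: suffix_length_le)
  then show ?thesis by simp
qed

lemma card_descendants_dyadic:
  assumes "z \<in> tree d" "length z = 2 ^ k" "k \<le> K"
  shows "card (descendants d z (2 ^ K)) = d ^ (K - k)"
proof -
  have "length z + (2 ^ K - 2 ^ k) = 2 ^ K" using assms by simp
  then show ?thesis using card_descendants[OF assms(1), of "2 ^ K - 2 ^ k"]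
      prod_num_children_dyadic[where k = k and j = "K - k" and d = d] assms by simp
qed

lemma card_level: "card (descendants d [] (2 ^ k)) = d ^ k"
proof -
  have "(\<Prod>i=0..<2 ^ k. num_children d i) = num_children d 0 * (\<Prod>i=Suc 0..<2 ^ k. num_children d i)"
    by (rule prod.atLeast_Suc_lessThan) simp
  also have "\<dots> = d ^ k"
    using prod_num_children_dyadic[where k = 0 and j = k and d = d] by (simp add: num_children_def)
  finally show ?thesis using card_descendants[OF tree.root, of d "2 ^ k"] by simp
qed

lemma card_level_Suc: "card (descendants d [] (Suc (2 ^ k))) = d ^ Suc k"
proof -
  have "num_children d (2 ^ k) = d" by (auto simp: num_children_def)
  then show ?thesis
    using card_descendants[OF tree.root, of d "Suc (2 ^ k)"] card_descendants[OF tree.root, of d "2 ^ k"]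
      card_level[of d k] by simp
qed

lemma card_descendants_Suc_dyadic:
  assumes "z \<in> tree d" "length z = Suc (2 ^ k)" "k < K" "d \<ge> 1"
  shows "card (descendants d z (2 ^ K)) = d ^ (K - Suc k)"
proof -
  have lt: "2 ^ k < (2 :: nat) ^ K" using assms by simp
  then have "length z + (2 ^ K - Suc (2 ^ k)) = 2 ^ K" unfolding assms(2) by linarith
  then have "card (descendants d z (2 ^ K)) = (\<Prod>i=Suc (2 ^ k)..<2 ^ K. num_children d i)"
    using card_descendants[OF assms(1), of "2 ^ K - Suc (2 ^ k)"] assms by simp
  moreover have "(\<Prod>i=2 ^ k..<2 ^ K. num_children d i) =
      num_children d (2 ^ k) * (\<Prod>i=Suc (2 ^ k)..<2 ^ K. num_children d i)"
    using lt by (rule prod.atLeast_Suc_lessThan)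
  moreover have "num_children d (2 ^ k) = d" by (auto simp: num_children_def)
  moreover have "(\<Prod>i=2 ^ k..<2 ^ K. num_children d i) = d * d ^ (K - Suc k)"
    using prod_num_children_dyadic[where k = k and j = "K - k" and d = d] assms
    by (simp flip: power_Suc add: Suc_diff_Suc)
  ultimately show ?thesis using assms(4) by simp
qed

section \<open>The asymptotics of the escape product\<close>


text \<open>For \<open>a > 0\<close> and \<open>k >= 1\<close> the reciprocal is the probability
  that the walk observed on a fresh geodesic passes from level 1 to level \<open>k\<close> before
  meeting the root: the passage from \<open>i\<close> to \<open>i + 1\<close> succeeds with
  probability i / (i + a).\<close>

definition esc_prod :: "real \<Rightarrow> nat \<Rightarrow> real" where
  "esc_prod a k = (\<Prod>i=1..<k. 1 + a / real i)"

text \<open>The gain of the potential per level of the branching point while the visited depth stays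
  at \<open>k\<close>.\<close>

definition slope :: "real \<Rightarrow> nat \<Rightarrow> real" where
  "slope a k = esc_prod a k / real k"

lemma esc_prod_Suc: "k \<ge> 1 \<Longrightarrow> esc_prod a (Suc k) = esc_prod a k * (1 + a / real k)"
  unfolding esc_prod_def by simp

lemma esc_prod_ge_1: "a > 0 \<Longrightarrow> esc_prod a k \<ge> 1"
  unfolding esc_prod_def by (intro prod_ge_1) auto

lemma esc_prod_mono:
  assumes "a > 0" "k \<le> l" shows "esc_prod a k \<le> esc_prod a l"
proof -
  have "esc_prod a k \<le> esc_prod a (Suc k)" for k
  proof (cases "k \<ge> 1")
    case True
    then show ?thesis
      using esc_prod_ge_1[OF assms(1), of k] assms(1) by (simp add: esc_prod_Suc)
  qed (simp add: esc_prod_def not_le)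
  then show ?thesis using assms(2) by (rule lift_Suc_mono_le)
qed

lemma slope_nonneg: "a > 0 \<Longrightarrow> slope a k \<ge> 0"
  unfolding slope_def using esc_prod_ge_1[of a k] by simp

lemma slope_pos: "a > 0 \<Longrightarrow> k \<ge> 1 \<Longrightarrow> slope a k > 0"
  unfolding slope_def using esc_prod_ge_1[of a k] by simp

lemma slope_mult: "k \<ge> 1 \<Longrightarrow> real k * slope a k = esc_prod a k"
  unfolding slope_def by simp

lemma slope_mult_le: "a > 0 \<Longrightarrow> real k * slope a k \<le> esc_prod a k"
  unfolding slope_def using esc_prod_ge_1[of a k] by (cases "k = 0") auto

text \<open>The balance at the frontier: crossing the fresh edge of weight 1 gains
  \<open>a * slope a k\<close>, which is what the crossed edge of weight \<open>a\<close> loses on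
  the way back.\<close>

lemma slope_Suc:
  assumes "k \<ge> 1" shows "(real k + 1) * slope a (Suc k) = (real k + a) * slope a k"
proof -
  have "(real k + 1) * slope a (Suc k) = esc_prod a (Suc k)"
    using slope_mult[of "Suc k" a] by (simp add: add.commute)
  also have "\<dots> = (real k + a) * slope a k"
    using assms by (simp add: esc_prod_Suc slope_def field_simps)
  finally show ?thesis .
qed

text \<open>\<open>esc_prod\<close> is monotone and \<open>m + b\<close> is at most
  \<open>2 * m\<close>, so the slope is at worst halved.\<close>

lemma slope_le_shift:
  assumes "a > 0" "1 \<le> b" "b \<le> m" shows "slope a m \<le> 2 * slope a (m + b)"
proof -
  have "slope a m \<le> esc_prod a (m + b) / real m"
    unfolding slope_def using esc_prod_mono[OF assms(1), of m "m + b"] assms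
    by (intro divide_right_mono) auto
  also have "\<dots> \<le> esc_prod a (m + b) * (2 / real (m + b))"
    using esc_prod_ge_1[OF assms(1), of "m + b"] assms
    by (subst divide_inverse, intro mult_left_mono) (auto simp: field_simps)
  also have "\<dots> = 2 * slope a (m + b)" by (simp add: slope_def)
  finally show ?thesis .
qed

lemma esc_prod_pochhammer:
  "k \<ge> 1 \<Longrightarrow> esc_prod a k * a * fact (k - 1) = pochhammer a k"
proof (induction k rule: nat_induct_at_least)
  case (Suc k)
  have "fact k = (real k * fact (k - 1) :: real)" using Suc by (simp add: fact_reduce)
  then have "esc_prod a (Suc k) * a * fact k = esc_prod a k * a * fact (k - 1) * (real k + a)"
    using Suc by (simp add: esc_prod_Suc field_simps)
  then show ?case using Suc by (simp add: pochhammer_Suc algebra_simps)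
qed (simp add: esc_prod_def)

lemma esc_prod_asymp:
  assumes "a > 0"
  shows "(\<lambda>n. real n powr a / esc_prod a n) \<longlonglongrightarrow> a * Gamma a"
proof -
  have "(\<lambda>n. a * Gamma_series' a n) \<longlonglongrightarrow> a * Gamma a"
    by (intro tendsto_mult tendsto_const Gamma_series'_LIMSEQ)
  then show ?thesis
  proof (rule Lim_transform_eventually)
    show "\<forall>\<^sub>F n in sequentially. a * Gamma_series' a n = real n powr a / esc_prod a n"
      using eventually_ge_at_top[of "1 :: nat"]
    proof eventually_elim
      case (elim n)
      then show ?case
        using assms esc_prod_ge_1[OF assms, of n]
        by (simp add: Gamma_series'_def esc_prod_pochhammer[symmetric] powr_def field_simps)
    qed
  qed
qed

text \<open>The ratio in \<open>esc_prod_asymp\<close> has a positive limit, so both it and its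
  inverse are bounded sequences.\<close>

lemma esc_prod_bounds:
  assumes "a > 0"
  obtains c C where "c > 0" "C > 0"
    "\<And>n. n \<ge> 1 \<Longrightarrow> c * real n powr a \<le> esc_prod a n"
    "\<And>n. n \<ge> 1 \<Longrightarrow> esc_prod a n \<le> C * real n powr a"
proof -
  let ?f = "\<lambda>n. real n powr a / esc_prod a n"
  have lim: "?f \<longlonglongrightarrow> a * Gamma a" by (rule esc_prod_asymp[OF assms])
  have pos: "a * Gamma a > 0" using assms by (simp add: Gamma_real_pos)
  have "Bseq ?f" using lim convergentI convergent_imp_Bseq by blast
  then obtain K where K: "K > 0" "\<And>n. norm (?f n) \<le> K" by (auto simp: Bseq_def)
  have "(\<lambda>n. inverse (?f n)) \<longlonglongrightarrow> inverse (a * Gamma a)"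
    using lim pos by (intro tendsto_inverse) auto
  then have "Bseq (\<lambda>n. inverse (?f n))" using convergentI convergent_imp_Bseq by blast
  then obtain C where C: "C > 0" "\<And>n. norm (inverse (?f n)) \<le> C" by (auto simp: Bseq_def)
  show ?thesis
  proof
    show "inverse K > 0" "C > 0" using K C by auto
    fix n :: nat assume n: "n \<ge> 1"
    have P: "esc_prod a n > 0" using esc_prod_ge_1[OF assms, of n] by linarith
    have "?f n \<le> K" using K(2)[of n] P by simp
    then show "inverse K * real n powr a \<le> esc_prod a n"
      using P K(1) by (simp add: field_simps)
    have "inverse (?f n) \<le> C" using C(2)[of n] P by simp
    then show "esc_prod a n \<le> C * real n powr a"
      using n by (simp add: field_simps)
  qed
qed

section \<open>Harmonic potentials\<close>


text \<open>
  An edge at the current position has been crossed iff its other endpoint has been visited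
  (\<open>edge_weight_eq_wt\<close> below), so the weight of an edge depends only on that endpoint.
\<close>

definition wt :: "real \<Rightarrow> 'v list \<Rightarrow> 'v \<Rightarrow> real" where
  "wt a h q = (if q \<in> set h then a else 1)"

text \<open>The conditional mean of \<open>F\<close> after one more step of the reinforced walk,
  given the history \<open>h\<close>.\<close>

definition step :: "nat \<Rightarrow> real \<Rightarrow> (nat list list \<Rightarrow> real) \<Rightarrow> nat list list \<Rightarrow> real" where
  "step d a F h =
    (\<Sum>q | adj d (hd h) q. wt a h q * F (q # h)) / (\<Sum>q | adj d (hd h) q. wt a h q)"

lemma wt_pos: "a > 0 \<Longrightarrow> wt a h q > 0"
  by (simp add: wt_def)

lemma neighbour_exists: "p \<in> tree d \<Longrightarrow> \<exists>q. adj d p q"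
proof (cases p)
  case Nil
  have "num_children d 0 = 1" by (simp add: num_children_def)
  then have "adj d [] [0]" by (auto simp: adj_def tree_Cons_iff intro: tree.root)
  then show ?thesis using Nil by auto
next
  case (Cons i q)
  then show "p \<in> tree d \<Longrightarrow> ?thesis" by (auto simp: adj_def tree_Cons_iff)
qed

lemma sum_wt_pos: "a > 0 \<Longrightarrow> p \<in> tree d \<Longrightarrow> (\<Sum>q | adj d p q. wt a h q) > 0"
  by (rule sum_pos) (use neighbour_exists wt_pos finite_neighbours in auto)

lemma walk_hd: "walk d h \<Longrightarrow> hd h \<in> set h" "walk d h \<Longrightarrow> hd h \<in> tree d"
  using walk_not_Nil walk_subset_tree by fastforce+

lemma step_mono:
  assumes "a > 0" "\<And>q. adj d (hd h) q \<Longrightarrow> F (q # h) \<le> G (q # h)"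
  shows "step d a F h \<le> step d a G h"
proof -
  have "wt a h q \<ge> 0" for q using wt_pos[OF assms(1)] by (rule less_imp_le)
  then show ?thesis
    unfolding step_def using assms by (intro divide_right_mono sum_mono mult_left_mono sum_nonneg) auto
qed

lemma step_cong:
  "(\<And>q. adj d (hd h) q \<Longrightarrow> F (q # h) = G (q # h)) \<Longrightarrow> step d a F h = step d a G h"
  unfolding step_def by (auto intro!: sum.cong arg_cong2[where f = "(/)"])

lemma step_const: "a > 0 \<Longrightarrow> walk d h \<Longrightarrow> step d a (\<lambda>h. c) h = c"
  unfolding step_def using sum_wt_pos[OF _ walk_hd(2), of a d h h]
  by (simp flip: sum_distrib_right)

lemma step_cmult: "step d a (\<lambda>h. c * F h) h = c * step d a F h"
  unfolding step_def by (simp add: sum_distrib_left mult.left_commute)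

lemma step_diff: "step d a (\<lambda>h. F h - G h) h = step d a F h - step d a G h"
  unfolding step_def by (simp add: algebra_simps sum_subtractf diff_divide_distrib)

lemma step_sum: "step d a (\<lambda>h. \<Sum>x\<in>A. F x h) h = (\<Sum>x\<in>A. step d a (F x) h)"
  unfolding step_def by (simp add: sum_distrib_left sum.swap[of _ A] flip: sum_divide_distrib)

lemma step_eqI:
  assumes "a > 0" "walk d h"
    and "(\<Sum>q | adj d (hd h) q. wt a h q * (F (q # h) - F h)) = 0"
  shows "step d a F h = F h"
proof -
  have "(\<Sum>q | adj d (hd h) q. wt a h q * F (q # h)) = (\<Sum>q | adj d (hd h) q. wt a h q) * F h"
    using assms(3) by (simp add: algebra_simps sum_subtractf sum_distrib_left)
  then show ?thesis
    unfolding step_def using sum_wt_pos[OF assms(1) walk_hd(2)[OF assms(2)], of h] by simp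
qed

text \<open>
  In the potentials below \<open>l\<close> is the level of the base vertex at which the walk is killed. The nat
  subtractions do not truncate as long as the walk stays in the subtree of the base vertex.
\<close>

definition path_pot :: "real \<Rightarrow> nat \<Rightarrow> nat list \<Rightarrow> nat list list \<Rightarrow> real" where
  "path_pot a l x h = (real (meet x (hd h)) - real l) * slope a (depth x (set h) - l)"

text \<open>
  Once both geodesics are known beyond their branching point at relative level \<open>b\<close>, the
  potential of a pair is that of single vertices with each branch viewed as \<open>b\<close> levels longer:
  the two unit slopes at the branching point then balance the slope 2 of the common part.
  Below the branching point both depths agree and only the last factor varies.
\<close>

definition pair_slope :: "real \<Rightarrow> nat \<Rightarrow> nat \<Rightarrow> nat \<Rightarrow> real" where
  "pair_slope a b m m' =
    slope a (max m b + b) * slope a (max m' b + b) * slope a (min m b) / slope a b"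

text \<open>For fixed depths this is affine in the two branching levels, which have zero total
  increment over the neighbours by \<open>sum_meet_neighbours\<close>.\<close>

definition pair_pot :: "real \<Rightarrow> nat \<Rightarrow> nat list \<Rightarrow> nat list \<Rightarrow> nat list list \<Rightarrow> real" where
  "pair_pot a l x y h = (real (meet x (hd h)) + real (meet y (hd h)) - 2 * real l) *
    pair_slope a (meet x y - l) (depth x (set h) - l) (depth y (set h) - l)"

text \<open>The parent of the current position is an ancestor of a visited vertex, hence visited, so
  only a child can be new.\<close>

lemma unvisited_neighbour:
  assumes "walk d h" "adj d (hd h) q" "q \<notin> set h"
  obtains i where "q = i # hd h"
proof -
  have "hd h \<noteq> i # q" for i
    using assms(3) walk_suffix_closed[OF assms(1) walk_hd(1)[OF assms(1)]]
    by (metis suffix_ConsI suffix_order.refl)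
  then show ?thesis using assms(2) that by (auto simp: adj_def)
qed

text \<open>
  Whether a neighbour is new or not, its contribution to the drift is proportional to the
  increment of the branching levels, and those increments cancel over all neighbours.
\<close>

lemma pair_pot_increment:
  assumes a: "a > 0" and h: "walk d h" and q: "adj d (hd h) q"
    and l: "l < length (hd h)" "l < meet x y"
  shows "wt a h q * (pair_pot a l x y (q # h) - pair_pot a l x y h) =
    a * pair_slope a (meet x y - l) (depth x (set h) - l) (depth y (set h) - l) *
    ((real (meet x q) - real (meet x (hd h))) + (real (meet y q) - real (meet y (hd h))))"
proof (cases "q \<in> set h")
  case True
  \<comment> \<open>Revisiting changes no depth, so the increment is linear in the branching levels
    and the weight of the edge supplies the factor \<open>a\<close>.\<close>
  then have "set (q # h) = set h" by auto
  then show ?thesis using True by (simp add: wt_def pair_pot_def algebra_simps)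
next
  case False
  define p where "p = hd h"
  have pV: "p \<in> set h" using walk_hd(1)[OF h] by (simp add: p_def)
  obtain i where qi: "q = i # p" unfolding p_def by (rule unvisited_neighbour[OF h q False])
  have wt: "wt a h q = 1" using False by (simp add: wt_def)
  have fin: "finite (set h)" "set h \<noteq> {}" using pV by auto
  have ins: "set (q # h) = insert q (set h)" by auto
  define b where "b = meet x y - l"
  define m where "m = length p - l"
  define sx where "sx = depth x (set h) - l"
  define sy where "sy = depth y (set h) - l"
  have m1: "m \<ge> 1" and b1: "b \<ge> 1" using l by (auto simp: m_def p_def b_def)
  have sb: "slope a b > 0" using slope_pos[OF a b1] .
  \<comment> \<open>If the fresh child \<open>q\<close> lies on the geodesic to \<open>z\<close>,
    the frontier of that geodesic was exactly \<open>p\<close> and now moves on by one.\<close>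
  have on: "meet z q = Suc (length p)" "meet z p = length p" "depth z (set h) = length p"
    "depth z (set (q # h)) = Suc (length p)" if "suffix q z" for z
  proof -
    show 1: "meet z q = Suc (length p)" "meet z p = length p"
      using that meet_eq_length[OF that] meet_eq_length[of p z] by (auto simp: qi dest: suffix_ConsD)
    show 2: "depth z (set h) = length p"
      using depth_unvisited[OF fin(1) pV, of i z] walk_suffix_closed[OF h] that False
      by (auto simp: qi)
    show "depth z (set (q # h)) = Suc (length p)"
      using depth_insert[OF fin, of z q] 1 2 by simp
  qed
  have off: "meet z q = meet z p" "depth z (set (q # h)) = depth z (set h)" if "\<not> suffix q z" for z
  proof -
    show 1: "meet z q = meet z p" using that by (simp add: qi)
    show "depth z (set (q # h)) = depth z (set h)"
      using depth_insert[OF fin, of z q] meet_le_depth[OF fin(1) pV, of z] 1 by simp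
  qed
  have lm: "l \<le> length p" "real m = real (length p) - real l" "Suc (length p) - l = Suc m"
    using l by (auto simp: m_def p_def)
  \<comment> \<open>Here only \<open>z\<close> lies beyond \<open>q\<close>. The other target
    \<open>w\<close> has branched off at relative level \<open>b\<close>, which is at most
    \<open>m\<close>, so the two relative levels add up to \<open>m + b\<close> and the recursion of
    \<open>slope\<close> is needed at \<open>m + b\<close>.\<close>
  have branch: "wt a h q * (pair_pot a l x y (q # h) - pair_pot a l x y h) =
      a * pair_slope a b sx sy *
      ((real (meet x q) - real (meet x p)) + (real (meet y q) - real (meet y p)))"
    if z: "suffix q z" and w: "\<not> suffix q w" and xy: "(x = z \<and> y = w) \<or> (x = w \<and> y = z)" for z w
  proof -
    have M: "meet w p = meet x y" "meet x y \<le> length p"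
      using meet_off_branch[of i p z w] z w xy meet_commute[of x y] by (auto simp: qi)
    define sw where "sw = depth w (set h) - l"
    have mb: "b \<le> m" using M by (simp add: b_def m_def)
    have rb: "real (meet x y) = real b + real l" using l by (simp add: b_def)
    have rec: "(real m + real b + 1) * slope a (Suc (m + b)) = (real m + real b + a) * slope a (m + b)"
      using slope_Suc[of "m + b" a] m1 by simp
    define R where "R = slope a (max sw b + b) * slope a (min (if x = z then m else sw) b) / slope a b"
    have dz: "depth z (set (q # h)) - l = Suc m" unfolding on(4)[OF z] lm(3) ..
    have dw: "depth w (set (q # h)) - l = sw" unfolding off(2)[OF w] sw_def ..
    have A: "pair_slope a b sx sy = slope a (m + b) * R"
      using xy z w mb on(3)[OF z] by (auto simp: pair_slope_def R_def sx_def sy_def sw_def m_def max_def)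
    have B: "pair_slope a b (depth x (set (q # h)) - l) (depth y (set (q # h)) - l) = slope a (Suc (m + b)) * R"
    proof -
      have "pair_slope a b (depth x (set (q # h)) - l) (depth y (set (q # h)) - l) =
          (if x = z then pair_slope a b (Suc m) sw else pair_slope a b sw (Suc m))"
        using xy z w dz dw by metis
      then show ?thesis using mb by (simp add: pair_slope_def R_def max_def min_def)
    qed
    have C: "real (meet x q) + real (meet y q) - 2 * real l = real m + real b + 1"
      "real (meet x p) + real (meet y p) - 2 * real l = real m + real b"
      "(real (meet x q) - real (meet x p)) + (real (meet y q) - real (meet y p)) = 1"
      using xy on(1,2)[OF z] off(1)[OF w] M rb lm by auto
    have "pair_pot a l x y (q # h) - pair_pot a l x y h =
        ((real m + real b + 1) * slope a (Suc (m + b)) - (real m + real b) * slope a (m + b)) * R"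
      unfolding pair_pot_def list.sel B C p_def[symmetric] A[unfolded sx_def sy_def b_def]
      using B C(1) by (simp add: algebra_simps b_def)
    also have "\<dots> = a * (slope a (m + b) * R)" unfolding rec by (simp add: algebra_simps)
    finally show ?thesis unfolding C A wt by simp
  qed
  consider (both) "suffix q x" "suffix q y" | (left) "suffix q x" "\<not> suffix q y"
    | (right) "\<not> suffix q x" "suffix q y" | (none) "\<not> suffix q x" "\<not> suffix q y" by blast
  then have "wt a h q * (pair_pot a l x y (q # h) - pair_pot a l x y h) =
      a * pair_slope a b sx sy *
      ((real (meet x q) - real (meet x p)) + (real (meet y q) - real (meet y p)))"
  proof cases
    case both
    \<comment> \<open>\<open>q\<close> is not beyond the branching point: both depths grow together
      and only the last factor of \<open>pair_slope\<close> changes.\<close>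
    have "length q \<le> meet x y" using both length_le_meet_iff by blast
    then have mb: "Suc m \<le> b" using lm by (auto simp: qi b_def)
    have rec: "(real m + 1) * slope a (Suc m) = (real m + a) * slope a m"
      using slope_Suc[OF m1] .
    define R where "R = slope a (b + b) * slope a (b + b) / slope a b"
    have A: "pair_slope a b sx sy = slope a m * R"
      using mb both on(3) by (auto simp: pair_slope_def R_def sx_def sy_def m_def max_def min_def)
    have B: "pair_slope a b (depth x (set (q # h)) - l) (depth y (set (q # h)) - l) = slope a (Suc m) * R"
      using mb both on(4) by (auto simp: pair_slope_def R_def lm max_def min_def)
    have C: "real (meet x q) + real (meet y q) - 2 * real l = 2 * (real m + 1)"
      "real (meet x p) + real (meet y p) - 2 * real l = 2 * real m"
      "(real (meet x q) - real (meet x p)) + (real (meet y q) - real (meet y p)) = 2"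
      using both on(1,2) lm by auto
    have "pair_pot a l x y (q # h) - pair_pot a l x y h =
        2 * ((real m + 1) * slope a (Suc m) - real m * slope a m) * R"
      unfolding pair_pot_def list.sel p_def[symmetric] A[unfolded sx_def sy_def b_def] C
      using B by (simp add: algebra_simps b_def)
    also have "\<dots> = a * (slope a m * R) * 2" unfolding rec by (simp add: algebra_simps)
    finally show ?thesis unfolding C A wt by simp
  next
    case left
    then show ?thesis using branch by blast
  next
    case right
    then show ?thesis using branch by blast
  next
    case none
    then show ?thesis using off by (simp add: pair_pot_def p_def[symmetric])
  qed
  then show ?thesis by (simp add: b_def sx_def sy_def p_def)
qed

lemma step_pair_pot:
  assumes a: "a > 0" and h: "walk d h" and xy: "x \<in> tree d" "y \<in> tree d"
    and l: "l < length (hd h)" "l < meet x y" and ne: "hd h \<noteq> x" "hd h \<noteq> y"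
  shows "step d a (pair_pot a l x y) h = pair_pot a l x y h"
proof (rule step_eqI[OF a h])
  have p: "hd h \<in> tree d" "hd h \<noteq> []" using walk_hd(2)[OF h] l by auto
  show "(\<Sum>q | adj d (hd h) q. wt a h q * (pair_pot a l x y (q # h) - pair_pot a l x y h)) = 0"
    using pair_pot_increment[OF a h _ l] sum_meet_neighbours[OF p xy(1) ne(1)]
      sum_meet_neighbours[OF p xy(2) ne(2)]
    by (simp add: sum.distrib flip: sum_distrib_left)
qed

text \<open>For \<open>x = y\<close> the branching point is \<open>x\<close> itself. No depth
  exceeds it, so the first two factors of \<open>pair_slope\<close> are frozen at their value for
  \<open>b + b\<close>.\<close>

lemma pair_pot_diag:
  assumes "a > 0" "walk d h" "l < length x"
  defines "b \<equiv> length x - l"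
  shows "pair_pot a l x x h = 2 * (slope a (b + b))\<^sup>2 / slope a b * path_pot a l x h"
proof -
  have "depth x (set h) \<le> length x"
    by (rule depth_le) (use walk_hd(1)[OF assms(2)] meet_le' in auto)
  moreover have "meet x x = length x" using meet_eq_length by blast
  ultimately show ?thesis
    by (simp add: pair_pot_def path_pot_def pair_slope_def b_def min_def max_def power2_eq_square)
qed

text \<open>The diagonal case of \<open>step_pair_pot\<close>, divided by the positive constant of
  \<open>pair_pot_diag\<close>.\<close>

lemma step_path_pot:
  assumes a: "a > 0" and h: "walk d h" and x: "x \<in> tree d" "l < length x"
    and l: "l < length (hd h)" and ne: "hd h \<noteq> x"
  shows "step d a (path_pot a l x) h = path_pot a l x h"
proof -
  define b where "b = length x - l"
  define c where "c = 2 * (slope a (b + b))\<^sup>2 / slope a b"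
  have b: "b \<ge> 1" using x by (simp add: b_def)
  have c: "c > 0" unfolding c_def using slope_pos[OF a, of b] slope_pos[OF a, of "b + b"] b by simp
  have mx: "l < meet x x" using x meet_eq_length[of x x] by simp
  have eq: "pair_pot a l x x g = c * path_pot a l x g" if "walk d g" for g
    using pair_pot_diag[OF a that x(2)] by (simp add: c_def b_def)
  have "c * step d a (path_pot a l x) h = step d a (pair_pot a l x x) h"
    unfolding step_cmult[symmetric] by (rule step_cong) (use eq h walk_step in metis)
  also have "\<dots> = c * path_pot a l x h"
    using step_pair_pot[OF a h x(1) x(1) l mx ne ne] eq[OF h] by simp
  finally show ?thesis using c by simp
qed

text \<open>This makes the second martingale dominate the square of the first. The 4 is the product
  of two factors 2 from \<open>slope_le_shift\<close>.\<close>

lemma path_pot_mult_le: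
  assumes a: "a > 0" and h: "walk d h"
    and x: "l \<le> meet x (hd h)" and y: "l \<le> meet y (hd h)" and l: "l < meet x y"
  shows "path_pot a l x h * path_pot a l y h \<le> 4 * real (meet x y - l) * pair_pot a l x y h"
proof -
  define b where "b = meet x y - l"
  define m where "m = depth x (set h) - l"
  define m' where "m' = depth y (set h) - l"
  define j where "j = real (meet x (hd h)) - real l"
  define j' where "j' = real (meet y (hd h)) - real l"
  note hd = walk_hd(1)[OF h]
  have fin: "finite (set h)" "set h \<noteq> {}" using hd by auto
  have b1: "b \<ge> 1" using l by (simp add: b_def)
  have j0: "j \<ge> 0" "j' \<ge> 0" using x y by (auto simp: j_def j'_def)
  have jm: "j \<le> real m"
    using meet_le_depth[OF fin(1) hd, of x] x by (simp add: j_def m_def)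
  have rb: "real b = real (meet x y) - real l" using l by (simp add: b_def)
  have sp: "slope a b > 0" by (rule slope_pos[OF a b1])
  have pair: "pair_pot a l x y h = (j + j') * pair_slope a b m m'"
    by (simp add: pair_pot_def j_def j'_def b_def m_def m'_def)
  have "j * slope a m * (j' * slope a m') \<le> 4 * real b * ((j + j') * pair_slope a b m m')"
  proof (cases "b \<le> m \<and> b \<le> m'")
    case True
    \<comment> \<open>The walk cannot share more than the branching point with both targets, so the
      smaller relative level is at most \<open>b\<close>.\<close>
    have "min j j' \<le> real b"
      using meet_ultrametric[of x "hd h" y] by (auto simp: rb j_def j'_def min_def split: if_splits)
    then have "j * j' \<le> real b * (j + j')"
    proof (cases "j \<le> j'")
      case True
      then have "j * j' \<le> real b * j'" using j0 \<open>min j j' \<le> real b\<close> by (intro mult_right_mono) auto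
      also have "\<dots> \<le> real b * (j + j')" using j0 by (intro mult_left_mono) auto
      finally show ?thesis .
    next
      case False
      then have "j' * j \<le> real b * j" using j0 \<open>min j j' \<le> real b\<close> by (intro mult_right_mono) auto
      also have "\<dots> \<le> real b * (j + j')" using j0 by (intro mult_left_mono) auto
      finally show ?thesis by (simp add: mult.commute)
    qed
    moreover have "slope a m * slope a m' \<le> (2 * slope a (m + b)) * (2 * slope a (m' + b))"
      using slope_le_shift[OF a b1] True slope_nonneg[OF a] by (intro mult_mono) auto
    ultimately have "(j * j') * (slope a m * slope a m') \<le>
        (real b * (j + j')) * ((2 * slope a (m + b)) * (2 * slope a (m' + b)))"
      by (rule mult_mono) (use j0 slope_nonneg[OF a] in auto)
    moreover have "pair_slope a b m m' = slope a (m + b) * slope a (m' + b)"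
      using True sp by (simp add: pair_slope_def max_absorb1 min_absorb2)
    ultimately show ?thesis by (simp add: algebra_simps)
  next
    case False
    \<comment> \<open>One geodesic is not yet explored up to the branching point, so both have the
      same depth, below \<open>b\<close>. Then \<open>j * slope a m\<close> is at most
      \<open>esc_prod a b\<close>, which is \<open>b * slope a b\<close>.\<close>
    have "depth x (set h) < meet x y \<or> depth y (set h) < meet x y"
      using False l by (auto simp: b_def m_def m'_def)
    then have "depth x (set h) = depth y (set h)"
      using depth_eq_below_branching[OF fin, of x y] depth_eq_below_branching[OF fin, of y x]
        meet_commute[of x y] by auto
    then have mm: "m = m'" "m < b" using False by (auto simp: m_def m'_def)
    let ?t = "slope a (b + b)"
    have ps: "pair_slope a b m m = ?t * ?t * slope a m / slope a b"
      using mm by (simp add: pair_slope_def max_absorb2 min_absorb1)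
    have sb: "slope a b \<le> 2 * ?t" using slope_le_shift[OF a b1, of b] by simp
    have "slope a b * slope a b \<le> (2 * ?t) * (2 * ?t)"
      using sb sp by (intro mult_mono) auto
    then have t: "slope a b \<le> 4 * (?t * ?t / slope a b)" using sp by (simp add: field_simps)
    have "j * slope a m \<le> real m * slope a m"
      using jm slope_nonneg[OF a] by (intro mult_right_mono) auto
    also have "\<dots> \<le> esc_prod a b"
      using slope_mult_le[OF a, of m] esc_prod_mono[OF a, of m b] mm by linarith
    also have "\<dots> = real b * slope a b" using slope_mult[OF b1] by simp
    also have "\<dots> \<le> real b * (4 * (?t * ?t / slope a b))" using t by (intro mult_left_mono) auto
    finally have "j * slope a m * (j' * slope a m) \<le> real b * (4 * (?t * ?t / slope a b)) * ((j + j') * slope a m)"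
      by (rule mult_mono) (use j0 slope_nonneg[OF a, of m] sp in \<open>auto intro: mult_right_mono\<close>)
    then show ?thesis unfolding mm(1)[symmetric] ps by (simp add: algebra_simps)
  qed
  then show ?thesis unfolding pair by (simp add: path_pot_def j_def j'_def m_def m'_def b_def)
qed

section \<open>The law of the history\<close>


primrec hist :: "(nat \<Rightarrow> 'v) \<Rightarrow> nat \<Rightarrow> 'v list" where
  "hist w 0 = [w 0]"
| "hist w (Suc n) = w (Suc n) # hist w n"

lemma length_hist [simp]: "length (hist w n) = Suc n"
  by (induction n) auto

lemma hist_not_Nil [simp]: "hist w n \<noteq> []"
  by (cases n) auto

lemma hd_hist [simp]: "hd (hist w n) = w n"
  by (cases n) auto

lemma set_hist [simp]: "set (hist w n) = w ` {..n}"
  by (induction n) (auto simp: atMost_Suc)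

definition tree_path :: "nat \<Rightarrow> (nat \<Rightarrow> nat list) \<Rightarrow> bool" where
  "tree_path d w \<longleftrightarrow> w 0 = [] \<and> (\<forall>n. adj d (w n) (w (Suc n)))"

lemma walk_hist: "tree_path d w \<Longrightarrow> walk d (hist w n)"
  by (induction n) (auto simp: tree_path_def intro: walk.intros)

text \<open>The first arrival at \<open>c\<close> comes from its parent: a child of \<open>c\<close>
  can only be occupied after \<open>c\<close> itself has been visited.\<close>

lemma crossed_parent:
  assumes "tree_path d w" "c \<in> w ` {..n}" "c \<noteq> []"
  shows "{tl c, c} \<in> crossed w n"
  using assms(2,3)
proof (induction n arbitrary: c)
  case 0
  then show ?case using assms(1) by (simp add: tree_path_def)
next
  case (Suc n)
  have mono: "crossed w n \<subseteq> crossed w (Suc n)" by (auto simp: crossed_def)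
  have now: "{w n, w (Suc n)} \<in> crossed w (Suc n)"
    unfolding crossed_def by (auto intro!: exI[of _ "Suc n"])
  show ?case
  proof (cases "c \<in> w ` {..n}")
    case True
    then show ?thesis using Suc mono by blast
  next
    case False
    then have c: "c = w (Suc n)" using Suc.prems by (auto simp: le_Suc_eq)
    have "w n \<noteq> i # c" for i
    proof
      assume "w n = i # c"
      then have "suffix c (w n)" by (simp add: suffix_ConsI)
      then have "c \<in> set (hist w n)"
        using walk_suffix_closed[OF walk_hist[OF assms(1)], of "w n" n c] by auto
      then show False using False by simp
    qed
    moreover have "adj d (w n) c" using assms(1) c by (auto simp: tree_path_def)
    ultimately have "w n = tl c" by (auto simp: adj_def)
    then show ?thesis using now c by simp
  qed
qed

lemma crossed_iff_visited:
  assumes "tree_path d w" "adj d (w n) y"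
  shows "{w n, y} \<in> crossed w n \<longleftrightarrow> y \<in> w ` {..n}"
proof
  assume "{w n, y} \<in> crossed w n"
  then obtain k where k: "1 \<le> k" "k \<le> n" "{w n, y} = {w (k - 1), w k}"
    by (auto simp: crossed_def)
  then have "y = w (k - 1) \<or> y = w k" by (auto simp: doubleton_eq_iff)
  then show "y \<in> w ` {..n}" using k by auto
next
  assume y: "y \<in> w ` {..n}"
  from assms(2) consider i where "y = i # w n" | i where "w n = i # y" by (auto simp: adj_def)
  then show "{w n, y} \<in> crossed w n"
  proof cases
    case 1
    then show ?thesis using crossed_parent[OF assms(1) y] by auto
  next
    case 2
    have "w n \<in> w ` {..n}" by simp
    from crossed_parent[OF assms(1) this] show ?thesis using 2 by (simp add: insert_commute)
  qed
qed

lemma edge_weight_eq_wt: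
  assumes "tree_path d w" "adj d (w n) y"
  shows "edge_weight a (crossed w n) {w n, y} = wt a (hist w n) y"
  using crossed_iff_visited[OF assms] by (simp add: edge_weight_def wt_def)

section \<open>The law of the walk given its finite history\<close>

context orrw
begin

abbreviation HX :: "nat \<Rightarrow> 'w \<Rightarrow> nat list list" where
  "HX n \<omega> \<equiv> hist (\<lambda>k. X k \<omega>) n"

lemma AE_tree_path: "AE \<omega> in M. tree_path d (\<lambda>k. X k \<omega>)"
  using start nearest_neighbour unfolding tree_path_def by (auto simp: AE_all_countable)

lemma sets_natural_filtration:
  "sets (natural_filtration M X n) = sigma_sets (space M) {X k -` A \<inter> space M | k A. k \<le> n}"
  "space (natural_filtration M X n) = space M"
  unfolding natural_filtration_def by (auto simp: space_measure_of_conv intro!: sets_measure_of)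

lemma hist_event_filtration:
  assumes "k \<le> n"
  shows "{\<omega> \<in> space M. HX k \<omega> = h} \<in> sets (natural_filtration M X n)"
  using assms
proof (induction k arbitrary: h)
  case 0
  have "{\<omega> \<in> space M. HX 0 \<omega> = h} = X 0 -` {x. [x] = h} \<inter> space M" by auto
  moreover have "X 0 -` {x. [x] = h} \<inter> space M \<in> sets (natural_filtration M X n)"
    unfolding sets_natural_filtration by (intro sigma_sets.Basic) blast
  ultimately show ?case by simp
next
  case (Suc k)
  have "{\<omega> \<in> space M. HX (Suc k) \<omega> = h} =
      (X (Suc k) -` {x. h \<noteq> [] \<and> x = hd h} \<inter> space M) \<inter> {\<omega> \<in> space M. HX k \<omega> = tl h}"
    by (cases h) auto
  moreover have "X (Suc k) -` {x. h \<noteq> [] \<and> x = hd h} \<inter> space M \<in> sets (natural_filtration M X n)"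
    unfolding sets_natural_filtration using Suc by (intro sigma_sets.Basic) blast
  ultimately show ?case using Suc by auto
qed

lemma measurable_hist [measurable]: "HX n \<in> measurable M (count_space UNIV)"
proof (rule measurable_count_space_eq2_countable[THEN iffD2], intro conjI ballI)
  fix h
  have "{\<omega> \<in> space M. HX n \<omega> = h} \<in> sets M"
    using hist_event_filtration[of n n h] subalgebra_natural_filtration
    by (auto simp: subalgebra_def)
  moreover have "{\<omega> \<in> space M. HX n \<omega> = h} = HX n -` {h} \<inter> space M" by auto
  ultimately show "HX n -` {h} \<inter> space M \<in> sets M" by simp
qed auto

lemma measurable_hist_pred: "Measurable.pred M (\<lambda>\<omega>. Q (HX n \<omega>))"
  by (rule measurable_compose[OF measurable_hist]) simp

lemma measurable_X_UNIV [measurable]: "X n \<in> measurable M (count_space UNIV)"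
proof -
  have "(\<lambda>\<omega>. hd (HX n \<omega>)) \<in> measurable M (count_space UNIV)" by measurable
  then show ?thesis by simp
qed

text \<open>The prescribed conditional probability is integrated over the event that the history
  equals \<open>h\<close>. This event lies in the natural filtration, and on it the probability is
  almost surely constant.\<close>

lemma prob_hist_Suc:
  assumes h: "length h = Suc n" and y: "adj d (hd h) y"
  shows "prob {\<omega> \<in> space M. HX (Suc n) \<omega> = y # h} =
    prob {\<omega> \<in> space M. HX n \<omega> = h} * (wt a h y / (\<Sum>z | adj d (hd h) z. wt a h z))"
proof -
  let ?F = "natural_filtration M X n"
  let ?A = "{\<omega> \<in> space M. HX n \<omega> = h}"
  let ?B = "{\<omega> \<in> space M. X (Suc n) \<omega> = y}"
  let ?p = "wt a h y / (\<Sum>z | adj d (hd h) z. wt a h z)"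
  interpret S: finite_measure_subalgebra M ?F
    by unfold_locales (rule subalgebra_natural_filtration)
  have A: "?A \<in> sets ?F" by (rule hist_event_filtration) simp
  have AM [measurable]: "?A \<in> sets M" by measurable
  have BM [measurable]: "?B \<in> sets M" by measurable
  have int: "integrable M (indicator ?B :: 'w \<Rightarrow> real)" using BM by (simp add: less_top[symmetric])
  have "AE \<omega> in M. \<omega> \<in> ?A \<longrightarrow> real_cond_exp M ?F (indicator ?B) \<omega> = ?p"
    using transition[OF y, of n] AE_tree_path
  proof eventually_elim
    case (elim \<omega>)
    show ?case
    proof
      assume "\<omega> \<in> ?A"
      then have hX: "hist (\<lambda>k. X k \<omega>) n = h" by simp
      then have hd: "X n \<omega> = hd h" using hd_hist[of "\<lambda>k. X k \<omega>" n] by simp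
      have "edge_weight a (crossed (\<lambda>k. X k \<omega>) n) {hd h, z} = wt a h z" if "adj d (hd h) z" for z
        using edge_weight_eq_wt[OF elim(2), of n z a] that by (simp add: hX hd)
      then show "real_cond_exp M ?F (indicator ?B) \<omega> = ?p" using elim(1) y hd by simp
    qed
  qed
  then have *: "AE \<omega> in M. indicator ?A \<omega> * real_cond_exp M ?F (indicator ?B) \<omega> = indicator ?A \<omega> * ?p"
    by eventually_elim (auto simp: indicator_def)
  have "{\<omega> \<in> space M. HX (Suc n) \<omega> = y # h} = ?A \<inter> ?B" by auto
  then have "prob {\<omega> \<in> space M. HX (Suc n) \<omega> = y # h} = (\<integral>\<omega>. indicator (?A \<inter> ?B) \<omega> \<partial>M)" by simp
  also have "\<dots> = (\<integral>\<omega>. indicator ?A \<omega> * indicator ?B \<omega> \<partial>M)" by (simp add: indicator_inter_arith)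
  also have "\<dots> = (\<integral>\<omega>. indicator ?A \<omega> * real_cond_exp M ?F (indicator ?B) \<omega> \<partial>M)"
    using S.real_cond_exp_intA[OF int A] by (simp add: set_lebesgue_integral_def)
  also have "\<dots> = (\<integral>\<omega>. indicator ?A \<omega> * ?p \<partial>M)"
    using * by (intro integral_cong_AE) auto
  also have "\<dots> = prob ?A * ?p" by simp
  finally show ?thesis .
qed

text \<open>The mean of \<open>F\<close> at the history up to time \<open>n\<close>, as a finite sum
  over the possible histories, so that no question of integrability arises.\<close>

definition walk_exp :: "nat \<Rightarrow> (nat list list \<Rightarrow> real) \<Rightarrow> real" where
  "walk_exp n F = (\<Sum>h | walk d h \<and> length h = Suc n. prob {\<omega> \<in> space M. HX n \<omega> = h} * F h)"

lemma walk_exp_mono: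
  "(\<And>h. walk d h \<Longrightarrow> length h = Suc n \<Longrightarrow> F h \<le> G h) \<Longrightarrow> walk_exp n F \<le> walk_exp n G"
  unfolding walk_exp_def by (intro sum_mono mult_left_mono) auto

lemma walk_exp_cmult: "walk_exp n (\<lambda>h. c * F h) = c * walk_exp n F"
  unfolding walk_exp_def by (simp add: sum_distrib_left mult.left_commute)

lemma walk_exp_add: "walk_exp n (\<lambda>h. F h + G h) = walk_exp n F + walk_exp n G"
  unfolding walk_exp_def by (simp add: algebra_simps sum.distrib)

text \<open>The tower property: a history with one more step is a history together with a neighbour
  of its head.\<close>

lemma walk_exp_Suc: "walk_exp (Suc n) F = walk_exp n (step d a F)"
proof -
  let ?S = "\<lambda>n. {h. walk d h \<and> length h = Suc n}"
  let ?f = "\<lambda>h. prob {\<omega> \<in> space M. HX (Suc n) \<omega> = h} * F h"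
  have eq: "?S (Suc n) = (\<lambda>(h, q). q # h) ` (SIGMA h:?S n. {q. adj d (hd h) q})" (is "_ = ?c ` ?R")
  proof (intro set_eqI iffI)
    fix h assume h: "h \<in> ?S (Suc n)"
    then have "walk d h" by simp
    then show "h \<in> ?c ` ?R" using h by cases (auto intro!: image_eqI[of _ _ "(h', q)" for h' q])
  qed (auto intro: walk_step)
  have "walk_exp (Suc n) F = (\<Sum>(h, q) \<in> ?R. ?f (q # h))"
    unfolding walk_exp_def eq by (subst sum.reindex) (auto simp: inj_on_def case_prod_beta)
  also have "\<dots> = (\<Sum>h\<in>?S n. \<Sum>q | adj d (hd h) q. ?f (q # h))"
    by (rule sum.Sigma[symmetric]) (use finite_walks finite_neighbours in auto)
  also have "\<dots> = walk_exp n (step d a F)"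
    unfolding walk_exp_def step_def
  proof (rule sum.cong[OF refl])
    fix h assume h: "h \<in> ?S n"
    let ?s = "\<Sum>z | adj d (hd h) z. wt a h z"
    have "(\<Sum>q | adj d (hd h) q. ?f (q # h)) =
        (\<Sum>q | adj d (hd h) q. prob {\<omega> \<in> space M. HX n \<omega> = h} * (wt a h q * F (q # h) / ?s))"
      using prob_hist_Suc[of h n] h by (intro sum.cong) auto
    then show "(\<Sum>q | adj d (hd h) q. ?f (q # h)) = prob {\<omega> \<in> space M. HX n \<omega> = h} *
        ((\<Sum>q | adj d (hd h) q. wt a h q * F (q # h)) / ?s)"
      by (simp add: sum_distrib_left sum_divide_distrib)
  qed
  finally show ?thesis .
qed

lemma prob_hist: "prob {\<omega> \<in> space M. Q (HX n \<omega>)} = walk_exp n (\<lambda>h. of_bool (Q h))"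
proof -
  let ?S = "{h. walk d h \<and> length h = Suc n}"
  let ?A = "\<lambda>h. {\<omega> \<in> space M. HX n \<omega> = h \<and> Q h}"
  have "prob {\<omega> \<in> space M. Q (HX n \<omega>)} = prob (\<Union>h\<in>?S. ?A h)"
  proof (rule finite_measure_eq_AE)
    show "AE \<omega> in M. \<omega> \<in> {\<omega> \<in> space M. Q (HX n \<omega>)} \<longleftrightarrow> \<omega> \<in> (\<Union>h\<in>?S. ?A h)"
      using AE_tree_path by eventually_elim (auto dest: walk_hist[where n = n])
    show "(\<Union>h\<in>?S. ?A h) \<in> sets M" by (rule sets.finite_UN) (auto simp: finite_walks)
  qed auto
  also have "\<dots> = (\<Sum>h\<in>?S. prob (?A h))"
    by (rule finite_measure_finite_Union) (auto simp: finite_walks disjoint_family_on_def)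
  also have "\<dots> = walk_exp n (\<lambda>h. of_bool (Q h))"
    unfolding walk_exp_def by (intro sum.cong refl) auto
  finally show ?thesis .
qed

lemma walk_exp_const: "walk_exp n (\<lambda>h. c) = c"
  using walk_exp_cmult[of n c "\<lambda>h. 1"] prob_hist[of "\<lambda>h. True" n] by (simp add: prob_space)

text \<open>Optional stopping for a nonnegative supermartingale \<open>H\<close> that is at least 1
  on the target \<open>A\<close> and is run until \<open>A\<close> or \<open>B\<close>. The
  condition \<open>C\<close> on the starting history lets the induction on \<open>t\<close> restart
  one step later.\<close>

lemma prob_hit_finite:
  assumes pos: "a > 0"
    and inv: "\<And>h q. walk d h \<Longrightarrow> I h \<Longrightarrow> \<not> A h \<Longrightarrow> \<not> B h \<Longrightarrow> adj d (hd h) q \<Longrightarrow> I (q # h)"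
    and H0: "\<And>h. walk d h \<Longrightarrow> I h \<Longrightarrow> 0 \<le> H h"
    and H1: "\<And>h. walk d h \<Longrightarrow> I h \<Longrightarrow> A h \<Longrightarrow> 1 \<le> H h"
    and super: "\<And>h. walk d h \<Longrightarrow> I h \<Longrightarrow> \<not> A h \<Longrightarrow> \<not> B h \<Longrightarrow> step d a H h \<le> H h"
    and C: "\<And>h. walk d h \<Longrightarrow> length h = Suc n \<Longrightarrow> C h \<Longrightarrow> I h"
  shows "prob {\<omega> \<in> space M. C (HX n \<omega>) \<and>
    (\<exists>s\<le>t. A (HX (n + s) \<omega>) \<and> (\<forall>u<s. \<not> B (HX (n + u) \<omega>)))} \<le>
    walk_exp n (\<lambda>h. of_bool (C h) * H h)"
  using C
proof (induction t arbitrary: n C)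
  case 0
  have "prob {\<omega> \<in> space M. C (HX n \<omega>) \<and>
      (\<exists>s\<le>0. A (HX (n + s) \<omega>) \<and> (\<forall>u<s. \<not> B (HX (n + u) \<omega>)))} =
      walk_exp n (\<lambda>h. of_bool (C h \<and> A h))"
    using prob_hist[of "\<lambda>h. C h \<and> A h" n] by simp
  also have "\<dots> \<le> walk_exp n (\<lambda>h. of_bool (C h) * H h)"
    using 0 H0 H1 by (intro walk_exp_mono) auto
  finally show ?case .
next
  case (Suc t)
  \<comment> \<open>\<open>C'\<close> holds if the previous history satisfied \<open>C\<close> and
    was not stopped there.\<close>
  define C' where "C' h \<longleftrightarrow> tl h \<noteq> [] \<and> C (tl h) \<and> \<not> A (tl h) \<and> \<not> B (tl h)" for h
  define E1 where "E1 = {\<omega> \<in> space M. C (HX n \<omega>) \<and> A (HX n \<omega>)}"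
  define E2 where "E2 = {\<omega> \<in> space M. C' (HX (Suc n) \<omega>) \<and>
    (\<exists>s\<le>t. A (HX (Suc n + s) \<omega>) \<and> (\<forall>u<s. \<not> B (HX (Suc n + u) \<omega>)))}"
  have [measurable]: "E1 \<in> sets M" "E2 \<in> sets M" unfolding E1_def E2_def by measurable
  have "{\<omega> \<in> space M. C (HX n \<omega>) \<and>
      (\<exists>s\<le>Suc t. A (HX (n + s) \<omega>) \<and> (\<forall>u<s. \<not> B (HX (n + u) \<omega>)))} \<subseteq> E1 \<union> E2"
  proof
    fix \<omega> assume "\<omega> \<in> {\<omega> \<in> space M. C (HX n \<omega>) \<and>
      (\<exists>s\<le>Suc t. A (HX (n + s) \<omega>) \<and> (\<forall>u<s. \<not> B (HX (n + u) \<omega>)))}"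
    then obtain s where s: "\<omega> \<in> space M" "C (HX n \<omega>)" "s \<le> Suc t" "A (HX (n + s) \<omega>)"
      "\<And>u. u < s \<Longrightarrow> \<not> B (HX (n + u) \<omega>)" by auto
    show "\<omega> \<in> E1 \<union> E2"
    proof (cases "A (HX n \<omega>)")
      case True
      then show ?thesis using s by (auto simp: E1_def)
    next
      case False
      then obtain s' where s': "s = Suc s'" using s by (cases s) auto
      have "\<not> B (HX n \<omega>)" using s(5)[of 0] s' by simp
      moreover have "\<not> B (HX (Suc n + u) \<omega>)" if "u < s'" for u
        using s(5)[of "Suc u"] s' that by simp
      ultimately have "\<omega> \<in> E2" using s s' False
        by (auto simp: E2_def C'_def intro!: exI[of _ s'])
      then show ?thesis by simp
    qed
  qed
  then have "prob {\<omega> \<in> space M. C (HX n \<omega>) \<and>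
      (\<exists>s\<le>Suc t. A (HX (n + s) \<omega>) \<and> (\<forall>u<s. \<not> B (HX (n + u) \<omega>)))} \<le> prob (E1 \<union> E2)"
    by (intro finite_measure_mono) auto
  also have "\<dots> \<le> prob E1 + prob E2" by (rule measure_Un_le) auto
  also have "prob E1 = walk_exp n (\<lambda>h. of_bool (C h \<and> A h))"
    unfolding E1_def by (rule prob_hist)
  also have "prob E2 \<le> walk_exp (Suc n) (\<lambda>h. of_bool (C' h) * H h)"
    unfolding E2_def
  proof (rule Suc.IH)
    fix h assume h: "walk d h" "length h = Suc (Suc n)" "C' h"
    from h(1) show "I h"
    proof cases
      case (walk_step g q)
      then show ?thesis using h Suc.prems[of g] inv[of g q] by (auto simp: C'_def)
    qed (use h in auto)
  qed
  also have "\<dots> = walk_exp n (\<lambda>h. of_bool (C h \<and> \<not> A h \<and> \<not> B h) * step d a H h)"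
  proof -
    have "step d a (\<lambda>h. of_bool (C' h) * H h) h = of_bool (C h \<and> \<not> A h \<and> \<not> B h) * step d a H h"
      if "walk d h" for h
      unfolding step_cmult[symmetric] using walk_not_Nil[OF that]
      by (intro step_cong) (auto simp: C'_def)
    then show ?thesis unfolding walk_exp_Suc by (auto simp: walk_exp_def intro!: sum.cong)
  qed
  \<comment> \<open>The two indicators are disjoint: \<open>H >= 1\<close> on \<open>A\<close> pays
    for the first term, the supermartingale property for the second.\<close>
  also have "walk_exp n (\<lambda>h. of_bool (C h \<and> A h)) + \<dots> \<le> walk_exp n (\<lambda>h. of_bool (C h) * H h)"
    unfolding walk_exp_add[symmetric]
    using Suc.prems H0 H1 super by (intro walk_exp_mono) auto
  finally show ?case by simp
qed

lemma prob_hit: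
  assumes "a > 0"
    and "\<And>h q. walk d h \<Longrightarrow> I h \<Longrightarrow> \<not> A h \<Longrightarrow> \<not> B h \<Longrightarrow> adj d (hd h) q \<Longrightarrow> I (q # h)"
    and "\<And>h. walk d h \<Longrightarrow> I h \<Longrightarrow> 0 \<le> H h"
    and "\<And>h. walk d h \<Longrightarrow> I h \<Longrightarrow> A h \<Longrightarrow> 1 \<le> H h"
    and "\<And>h. walk d h \<Longrightarrow> I h \<Longrightarrow> \<not> A h \<Longrightarrow> \<not> B h \<Longrightarrow> step d a H h \<le> H h"
    and "\<And>h. walk d h \<Longrightarrow> length h = Suc n \<Longrightarrow> I h"
  shows "prob {\<omega> \<in> space M. \<exists>s. A (HX (n + s) \<omega>) \<and> (\<forall>u<s. \<not> B (HX (n + u) \<omega>))} \<le> walk_exp n H"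
proof -
  define E where "E t = {\<omega> \<in> space M. \<exists>s\<le>t. A (HX (n + s) \<omega>) \<and> (\<forall>u<s. \<not> B (HX (n + u) \<omega>))}" for t
  have le: "prob (E t) \<le> walk_exp n H" for t
    using prob_hit_finite[of I A B H n "\<lambda>_. True" t] assms by (simp add: E_def)
  have "range E \<subseteq> sets M" unfolding E_def by auto
  moreover have "incseq E" by (auto simp: incseq_def E_def intro: order.trans)
  ultimately have "(\<lambda>t. prob (E t)) \<longlonglongrightarrow> prob (\<Union>t. E t)"
    by (rule finite_Lim_measure_incseq)
  then have "prob (\<Union>t. E t) \<le> walk_exp n H" by (rule LIMSEQ_le_const2) (use le in auto)
  moreover have "(\<Union>t. E t) =
      {\<omega> \<in> space M. \<exists>s. A (HX (n + s) \<omega>) \<and> (\<forall>u<s. \<not> B (HX (n + u) \<omega>))}"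
    by (auto simp: E_def)
  ultimately show ?thesis by simp
qed

end

section \<open>Recurrence\<close>


text \<open>Counts visits from time \<open>n\<close> on, except the current position, which
  \<open>tl\<close> drops: a visit counts only once the walk has made its next step.\<close>

definition visits :: "'v \<Rightarrow> nat \<Rightarrow> 'v list \<Rightarrow> nat" where
  "visits u n h = length (filter ((=) u) (take (length h - Suc n) (tl h)))"

lemma visits_Cons:
  "Suc n \<le> length h \<Longrightarrow> visits u n (q # h) = of_bool (hd h = u) + visits u n h"
  by (cases h) (auto simp: visits_def Suc_diff_le)

lemma visits_hist: "visits u n (hist w (n + s)) = card {m. n \<le> m \<and> m < n + s \<and> w m = u}"
proof (induction s)
  case 0
  then show ?case by (simp add: visits_def)
next
  case (Suc s)
  have "{m. n \<le> m \<and> m < n + Suc s \<and> w m = u} =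
      (if w (n + s) = u then {n + s} else {}) \<union> {m. n \<le> m \<and> m < n + s \<and> w m = u}"
    by (auto simp: less_Suc_eq)
  then have "card {m. n \<le> m \<and> m < n + Suc s \<and> w m = u} =
      of_bool (w (n + s) = u) + card {m. n \<le> m \<and> m < n + s \<and> w m = u}"
    by simp
  then show ?case using Suc visits_Cons[of n "hist w (n + s)" u "w (Suc (n + s))"] by simp
qed

lemma visits_unbounded:
  assumes "infinite {m. w m = u}" shows "\<exists>s. K \<le> visits u n (hist w (n + s))"
proof -
  have "infinite ({m. w m = u} - {..<n})" using assms by (rule Diff_infinite_finite[rotated]) simp
  then obtain T where T: "T \<subseteq> {m. w m = u} - {..<n}" "finite T" "card T = K"
    using infinite_arbitrarily_large by blast
  define s where "s = Suc (Max (insert 0 T))"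
  have "m < s" if "m \<in> T" for m using T(2) that by (simp add: s_def le_imp_less_Suc)
  then have "T \<subseteq> {m. n \<le> m \<and> m < n + s \<and> w m = u}" using T(1) by fastforce
  then have "K \<le> card {m. n \<le> m \<and> m < n + s \<and> w m = u}"
    unfolding T(3)[symmetric] by (intro card_mono) auto
  then show ?thesis unfolding visits_hist by blast
qed

text \<open>Every weight lies between \<open>min 1 a\<close> and \<open>max 1 a\<close>, so the
  bound is the same for all histories ending at the same vertex.\<close>

lemma step_indicator_ge:
  assumes a: "a > 0" and h: "walk d h" and v: "adj d (hd h) v"
  shows "min 1 a / (real (card {q. adj d (hd h) q}) * max 1 a) \<le>
    step d a (\<lambda>h. of_bool (hd h = v)) h"
proof -
  let ?N = "{q. adj d (hd h) q}"
  have eq: "step d a (\<lambda>h. of_bool (hd h = v)) h = wt a h v / (\<Sum>q\<in>?N. wt a h q)"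
  proof -
    have "(\<Sum>q\<in>?N. wt a h q * of_bool (hd (q # h) = v)) = (\<Sum>q\<in>?N. if q = v then wt a h q else 0)"
      by (intro sum.cong) auto
    also have "\<dots> = wt a h v" using v finite_neighbours by (subst sum.delta) auto
    finally show ?thesis by (simp add: step_def)
  qed
  have "(\<Sum>q\<in>?N. wt a h q) \<le> real (card ?N) * max 1 a"
    by (rule sum_bounded_above) (auto simp: wt_def)
  then show ?thesis unfolding eq
    using sum_wt_pos[OF a walk_hd(2)[OF h], of h] a by (intro frac_le) (auto simp: wt_def)
qed

context orrw
begin

lemma AE_not_if_bounds:
  assumes "\<And>K :: nat. E K \<in> sets M" "\<And>K. prob (E K) \<le> f K" "f \<longlonglongrightarrow> 0"
    and "\<And>\<omega> K. \<omega> \<in> space M \<Longrightarrow> Q \<omega> \<Longrightarrow> \<omega> \<in> E K"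
  shows "AE \<omega> in M. \<not> Q \<omega>"
proof (rule AE_I')
  have sets: "(\<Inter>K. E K) \<in> sets M" using assms(1) by (intro sets.countable_INT) auto
  have "prob (\<Inter>K. E K) \<le> f K" for K
    using finite_measure_mono[of "\<Inter>K. E K" "E K"] assms(1,2)[of K] by fastforce
  then have "prob (\<Inter>K. E K) \<le> 0" by (intro LIMSEQ_le_const[OF assms(3)]) auto
  then have "prob (\<Inter>K. E K) = 0" using measure_nonneg[of M "\<Inter>K. E K"] by linarith
  then show "(\<Inter>K. E K) \<in> null_sets M" using sets by (auto simp: null_sets_def emeasure_eq_measure)
  show "{\<omega> \<in> space M. \<not> \<not> Q \<omega>} \<subseteq> (\<Inter>K. E K)" using assms(4) by auto
qed

text \<open>Each departure from \<open>u\<close> hits \<open>v\<close> with conditional probability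
  at least \<open>c\<close>. Hence \<open>1 - c\<close> to the number of visits still missing, set
  to 0 once \<open>v\<close> is hit, is a supermartingale.\<close>

lemma prob_many_visits:
  assumes a: "a > 0" and uv: "adj d u v"
  defines "c \<equiv> min 1 a / (real (card {q. adj d u q}) * max 1 a)"
  shows "prob {\<omega> \<in> space M. \<exists>s. (K \<le> visits u n (HX (n + s) \<omega>) \<and> hd (HX (n + s) \<omega>) \<noteq> v) \<and>
    (\<forall>r<s. \<not> hd (HX (n + r) \<omega>) = v)} \<le> (1 - c) ^ K"
proof -
  define H where "H h = (if hd h = v then 0 else (1 - c) ^ (K - visits u n h))" for h
  have "card {q. adj d u q} \<ge> 1"
    using uv finite_neighbours by (auto simp: Suc_le_eq card_gt_0_iff)
  then have "1 * min 1 a \<le> real (card {q. adj d u q}) * max 1 a"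
    using a by (intro mult_mono) auto
  then have c: "c \<le> 1" "0 \<le> c" using a by (auto simp: c_def divide_le_eq_1)
  have "prob {\<omega> \<in> space M. \<exists>s. (K \<le> visits u n (HX (n + s) \<omega>) \<and> hd (HX (n + s) \<omega>) \<noteq> v) \<and>
      (\<forall>r<s. \<not> hd (HX (n + r) \<omega>) = v)} \<le> walk_exp n H"
  proof (rule prob_hit[where I = "\<lambda>h. Suc n \<le> length h"])
    fix h :: "nat list list"
    assume h: "walk d h" "Suc n \<le> length h"
    show "0 \<le> H h" using c by (simp add: H_def)
    show "1 \<le> H h" if "K \<le> visits u n h \<and> hd h \<noteq> v" using that by (simp add: H_def)
    show "step d a H h \<le> H h"
      if nA: "\<not> (K \<le> visits u n h \<and> hd h \<noteq> v)" and nB: "hd h \<noteq> v"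
    proof (cases "hd h = u")
      case True
      define k where "k = K - Suc (visits u n h)"
      have Kk: "K - visits u n h = Suc k" using nA nB by (simp add: k_def)
      have "step d a H h \<le> step d a (\<lambda>g. (1 - c) ^ k * (1 - of_bool (hd g = v))) h"
        using visits_Cons[OF h(2)] True c by (intro step_mono a) (auto simp: H_def k_def)
      also have "\<dots> = (1 - c) ^ k * (1 - step d a (\<lambda>g. of_bool (hd g = v)) h)"
        by (simp only: step_cmult step_diff step_const[OF a h(1)])
      also have "\<dots> \<le> (1 - c) ^ k * (1 - c)"
        using step_indicator_ge[OF a h(1), of v] uv True c
        by (intro mult_left_mono) (auto simp: c_def)
      also have "\<dots> = H h" using nB Kk by (simp add: H_def)
      finally show ?thesis .
    next
      case False
      have "step d a H h \<le> step d a (\<lambda>g. H h) h"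
        using visits_Cons[OF h(2)] False nB c by (intro step_mono a) (auto simp: H_def)
      then show ?thesis using step_const[OF a h(1)] by simp
    qed
  qed (use a in auto)
  also have "\<dots> \<le> walk_exp n (\<lambda>h. (1 - c) ^ K)"
    using c by (intro walk_exp_mono) (auto simp: H_def visits_def)
  finally show ?thesis by (simp add: walk_exp_const)
qed

text \<open>Takes the place of a conditional Borel-Cantelli argument: avoiding \<open>v\<close> from
  time \<open>n\<close> on while returning to \<open>u\<close> forever has probability at most
  \<open>(1 - c) ^ K\<close> for every \<open>K\<close>.\<close>

lemma AE_infinitely_often_neighbour:
  assumes a: "a > 0" and uv: "adj d u v"
  shows "AE \<omega> in M. infinite {m. X m \<omega> = u} \<longrightarrow> infinite {m. X m \<omega> = v}"
proof -
  define c where "c = min 1 a / (real (card {q. adj d u q}) * max 1 a)"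
  have card: "card {q. adj d u q} \<ge> 1"
    using uv finite_neighbours by (auto simp: Suc_le_eq card_gt_0_iff)
  then have "1 * min 1 a \<le> real (card {q. adj d u q}) * max 1 a"
    using a by (intro mult_mono) auto
  moreover have "real (card {q. adj d u q}) * max 1 a > 0"
    using card by (intro mult_pos_pos) auto
  ultimately have c: "c \<le> 1" "0 < c" using a by (auto simp: c_def divide_le_eq_1)
  have "AE \<omega> in M. \<not> ((\<forall>m\<ge>n. X m \<omega> \<noteq> v) \<and> infinite {m. X m \<omega> = u})" for n
  proof (rule AE_not_if_bounds)
    fix K :: nat
    let ?E = "{\<omega> \<in> space M. \<exists>s. (K \<le> visits u n (HX (n + s) \<omega>) \<and> hd (HX (n + s) \<omega>) \<noteq> v) \<and>
      (\<forall>r<s. \<not> hd (HX (n + r) \<omega>) = v)}"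
    show "?E \<in> sets M" by measurable
    show "prob ?E \<le> (1 - c) ^ K" unfolding c_def by (rule prob_many_visits[OF a uv])
    fix \<omega> assume \<omega>: "\<omega> \<in> space M" "(\<forall>m\<ge>n. X m \<omega> \<noteq> v) \<and> infinite {m. X m \<omega> = u}"
    then obtain s where "K \<le> visits u n (HX (n + s) \<omega>)"
      using visits_unbounded[of "\<lambda>m. X m \<omega>" u K n] by auto
    then show "\<omega> \<in> ?E" using \<omega> by (auto intro!: exI[of _ s])
  qed (use c in \<open>auto intro: LIMSEQ_power_zero\<close>)
  then have "AE \<omega> in M. \<forall>n. \<not> ((\<forall>m\<ge>n. X m \<omega> \<noteq> v) \<and> infinite {m. X m \<omega> = u})"
    unfolding AE_all_countable by blast
  then show ?thesis
  proof eventually_elim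
    case (elim \<omega>)
    show ?case
    proof (intro impI notI)
      assume "infinite {m. X m \<omega> = u}" "finite {m. X m \<omega> = v}"
      moreover from this(2) obtain n where "\<forall>m\<in>{m. X m \<omega> = v}. m < n"
        using finite_nat_set_iff_bounded by blast
      ultimately show False using elim by (metis mem_Collect_eq not_less)
    qed
  qed
qed

text \<open>The dichotomy behind both halves of the theorem: almost surely, either all vertices of
  the tree are visited infinitely often or none is.\<close>

lemma AE_infinitely_often:
  assumes a: "a > 0"
  shows "AE \<omega> in M. \<forall>u\<in>tree d. \<forall>v\<in>tree d.
    infinite {m. X m \<omega> = u} \<longrightarrow> infinite {m. X m \<omega> = v}"
proof -
  have "AE \<omega> in M. \<forall>u v. adj d u v \<longrightarrow>
      infinite {m. X m \<omega> = u} \<longrightarrow> infinite {m. X m \<omega> = v}"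
    unfolding AE_all_countable using AE_infinitely_often_neighbour[OF a] by auto
  then show ?thesis
  proof eventually_elim
    case (elim \<omega>)
    have "infinite {m. X m \<omega> = u} \<longleftrightarrow> infinite {m. X m \<omega> = []}" if "u \<in> tree d" for u
      using that
    proof (induction rule: tree.induct)
      case (child v i)
      then have "adj d v (i # v)" "adj d (i # v) v" by (auto simp: adj_def intro: tree.intros)
      then show ?case using child elim by blast
    qed auto
    then show ?case by blast
  qed
qed

section \<open>Reaching a high level before the root\<close>

lemma path_pot_le:
  assumes a: "a > 0" and h: "walk d h" "length h = Suc n"
  shows "path_pot a 0 x h \<le> esc_prod a n"
proof -
  note hd = walk_hd(1)[OF h(1)]
  have "depth x (set h) \<le> n"
  proof (rule depth_le)
    fix v assume "v \<in> set h"
    then show "meet x v \<le> n" using walk_length_le[OF h(1)] meet_le[of x v] h(2) by fastforce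
  qed (use hd in auto)
  moreover have "real (meet x (hd h)) * slope a (depth x (set h)) \<le>
      real (depth x (set h)) * slope a (depth x (set h))"
    using meet_le_depth[OF _ hd, of x] slope_nonneg[OF a] by (intro mult_right_mono) auto
  ultimately show ?thesis
    using slope_mult_le[OF a, of "depth x (set h)"] esc_prod_mono[OF a, of "depth x (set h)" n]
    by (simp add: path_pot_def)
qed

text \<open>A union bound over level \<open>N\<close>, expressed by summing the potentials. Starting
  at an arbitrary time \<open>n\<close> costs only the factor \<open>esc_prod a n\<close>, which
  does not depend on \<open>N\<close>.\<close>

lemma prob_reach_level:
  assumes a: "a > 0" and N: "N \<ge> 1"
  shows "prob {\<omega> \<in> space M. \<exists>s. length (hd (HX (n + s) \<omega>)) = N \<and>
    (\<forall>r<s. \<not> hd (HX (n + r) \<omega>) = [])} \<le>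
    real (card (descendants d [] N)) * esc_prod a n / esc_prod a N"
proof -
  let ?L = "descendants d [] N"
  define H where "H h = (1 / esc_prod a N) * (\<Sum>x\<in>?L. path_pot a 0 x h)" for h
  have P: "esc_prod a N > 0" using esc_prod_ge_1[OF a, of N] by linarith
  have nonneg: "path_pot a 0 x h \<ge> 0" for x h
    by (simp add: path_pot_def slope_nonneg[OF a])
  have finL: "finite ?L" by (intro finite_descendants tree.root)
  have "prob {\<omega> \<in> space M. \<exists>s. length (hd (HX (n + s) \<omega>)) = N \<and>
      (\<forall>r<s. \<not> hd (HX (n + r) \<omega>) = [])} \<le> walk_exp n H"
  proof (rule prob_hit[where I = "\<lambda>_. True"])
    fix h :: "nat list list" assume h: "walk d h"
    show "0 \<le> H h" unfolding H_def using P nonneg by (intro mult_nonneg_nonneg sum_nonneg) auto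
    show "1 \<le> H h" if len: "length (hd h) = N"
    proof -
      have x: "hd h \<in> ?L" using walk_hd(2)[OF h] len by (simp add: descendants_def)
      have m: "meet (hd h) (hd h) = N" using meet_eq_length[of "hd h" "hd h"] len by simp
      then have "N \<le> depth (hd h) (set h)"
        using meet_le_depth[OF _ walk_hd(1)[OF h], of "hd h"] by simp
      moreover have "depth (hd h) (set h) \<le> N"
        by (rule depth_le) (use walk_hd(1)[OF h] meet_le'[of "hd h"] len in auto)
      ultimately have "path_pot a 0 (hd h) h = esc_prod a N"
        using m slope_mult[OF N, of a] by (simp add: path_pot_def)
      then have "esc_prod a N \<le> (\<Sum>x\<in>?L. path_pot a 0 x h)"
        using member_le_sum[OF x, of "\<lambda>x. path_pot a 0 x h"] nonneg finL by simp
      then show ?thesis using P by (simp add: H_def)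
    qed
    show "step d a H h \<le> H h" if "length (hd h) \<noteq> N" "hd h \<noteq> []"
    proof -
      have "step d a (path_pot a 0 x) h = path_pot a 0 x h" if "x \<in> ?L" for x
        using that \<open>length (hd h) \<noteq> N\<close> \<open>hd h \<noteq> []\<close> N
        by (intro step_path_pot a h) (auto simp: descendants_def)
      then show ?thesis unfolding H_def step_cmult step_sum by simp
    qed
  qed (use a in auto)
  also have "\<dots> \<le> walk_exp n (\<lambda>h. (1 / esc_prod a N) * (real (card ?L) * esc_prod a n))"
    unfolding H_def using P path_pot_le[OF a]
    by (intro walk_exp_mono mult_left_mono sum_bounded_above) auto
  finally show ?thesis by (simp add: walk_exp_const)
qed

lemma AE_not_escape:
  assumes a: "a > 0" and d: "d \<ge> 1" and da: "real d < 2 powr a"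
  shows "AE \<omega> in M. \<not> (tree_path d (\<lambda>k. X k \<omega>) \<and> (\<forall>m\<ge>n. X m \<omega> \<noteq> []) \<and>
    (\<forall>u. finite {m. X m \<omega> = u}))"
proof -
  obtain c C where c: "c > 0" "\<And>n. n \<ge> 1 \<Longrightarrow> c * real n powr a \<le> esc_prod a n"
    using esc_prod_bounds[OF a] by metis
  define \<rho> where "\<rho> = real d / 2 powr a"
  have \<rho>: "0 \<le> \<rho>" "\<rho> < 1" using da by (auto simp: \<rho>_def divide_less_eq)
  show ?thesis
  proof (rule AE_not_if_bounds)
    fix K :: nat
    \<comment> \<open>The summand \<open>n\<close> in the exponent pushes the level above
      \<open>n\<close>, so it cannot be reached before time \<open>n\<close>.\<close>
    let ?N = "2 ^ (K + n) :: nat"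
    let ?E = "{\<omega> \<in> space M. \<exists>s. length (hd (HX (n + s) \<omega>)) = ?N \<and>
      (\<forall>r<s. \<not> hd (HX (n + r) \<omega>) = [])}"
    show "?E \<in> sets M" by measurable
    have "prob ?E \<le> real (card (descendants d [] ?N)) * esc_prod a n / esc_prod a ?N"
      by (rule prob_reach_level[OF a]) simp
    also have "\<dots> = real d ^ (K + n) * esc_prod a n / esc_prod a ?N" by (simp add: card_level)
    also have "\<dots> \<le> real d ^ (K + n) * esc_prod a n / (c * (2 powr a) ^ (K + n))"
    proof (rule divide_left_mono)
      have "real ?N powr a = (2 powr a) ^ (K + n)"
        by (simp add: powr_realpow[symmetric] powr_powr mult.commute)
      then show "c * (2 powr a) ^ (K + n) \<le> esc_prod a ?N" using c(2)[of ?N] by simp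
      show "0 \<le> real d ^ (K + n) * esc_prod a n"
        using esc_prod_ge_1[OF a, of n] by simp
      show "0 < esc_prod a ?N * (c * (2 powr a) ^ (K + n))"
        using esc_prod_ge_1[OF a, of ?N] c by simp
    qed
    also have "\<dots> = esc_prod a n / c * \<rho> ^ (K + n)" by (simp add: \<rho>_def power_divide)
    finally show "prob ?E \<le> esc_prod a n / c * \<rho> ^ (K + n)" .
    fix \<omega> assume \<omega>: "\<omega> \<in> space M" and Q: "tree_path d (\<lambda>k. X k \<omega>) \<and> (\<forall>m\<ge>n. X m \<omega> \<noteq> []) \<and>
      (\<forall>u. finite {m. X m \<omega> = u})"
    have inT: "X m \<omega> \<in> tree d" for m
      using walk_hd(2)[OF walk_hist[of d "\<lambda>k. X k \<omega>" m]] Q by simp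
    have "\<exists>t. ?N \<le> length (X t \<omega>)"
    proof (rule ccontr)
      assume "\<nexists>t. ?N \<le> length (X t \<omega>)"
      then have "UNIV \<subseteq> (\<Union>i<?N. \<Union>u\<in>descendants d [] i. {m. X m \<omega> = u})"
        using inT by (auto simp: descendants_def not_le)
      moreover have "finite (\<Union>i<?N. \<Union>u\<in>descendants d [] i. {m. X m \<omega> = u})"
        using Q finite_descendants[OF tree.root] by auto
      ultimately show False using finite_subset infinite_UNIV_nat by blast
    qed
    then obtain t where t: "?N \<le> length (X t \<omega>)" by blast
    \<comment> \<open>At time \<open>t\<close> the walk may be beyond level \<open>?N\<close>; its
      ancestor at that level has been visited on the way.\<close>
    define z where "z = drop (length (X t \<omega>) - ?N) (X t \<omega>)"
    have z: "length z = ?N" using t by (simp add: z_def)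
    have "z \<in> set (HX t \<omega>)"
      by (rule walk_suffix_closed[OF walk_hist[of d "\<lambda>k. X k \<omega>" t], of "X t \<omega>"])
        (use Q in \<open>auto simp: z_def suffix_drop\<close>)
    then obtain s where s: "X s \<omega> = z" by auto
    have "length z < Suc s"
      using walk_length_le[OF walk_hist[of d "\<lambda>k. X k \<omega>" s], of z] Q s by auto
    moreover have "n < ?N" by (meson le_add2 less_exp less_le_trans one_le_numeral power_increasing)
    ultimately have "n \<le> s" using z by simp
    then show "\<omega> \<in> ?E" using \<omega> Q s z by (auto intro!: exI[of _ "s - n"])
  next
    have "(\<lambda>K. esc_prod a n / c * \<rho> ^ (K + n)) \<longlonglongrightarrow> esc_prod a n / c * 0"
      using \<rho> by (intro tendsto_mult tendsto_const LIMSEQ_ignore_initial_segment LIMSEQ_power_zero) auto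
    then show "(\<lambda>K. esc_prod a n / c * \<rho> ^ (K + n)) \<longlonglongrightarrow> 0" by simp
  qed
qed

lemma recurrent:
  assumes a: "a > 0" and d: "d \<ge> 1" and da: "real d < 2 powr a"
  shows "as_recurrent M X"
proof -
  have "AE \<omega> in M. \<forall>n. \<not> (tree_path d (\<lambda>k. X k \<omega>) \<and> (\<forall>m\<ge>n. X m \<omega> \<noteq> []) \<and>
      (\<forall>u. finite {m. X m \<omega> = u}))"
    unfolding AE_all_countable using AE_not_escape[OF assms] by blast
  then show ?thesis
    unfolding as_recurrent_def using AE_tree_path AE_infinitely_often[OF a]
  proof eventually_elim
    case (elim \<omega>)
    show ?case
    proof
      assume fin: "finite {n. X n \<omega> = []}"
      then obtain n where "\<forall>m\<in>{m. X m \<omega> = []}. m < n"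
        using finite_nat_set_iff_bounded by blast
      then have "\<forall>m\<ge>n. X m \<omega> \<noteq> []" by (metis mem_Collect_eq not_less)
      moreover have "finite {m. X m \<omega> = u}" for u
      proof (cases "u \<in> tree d")
        case True
        then show ?thesis using elim(3) fin tree.root by blast
      next
        case False
        have "X m \<omega> \<in> tree d" for m
          using walk_hd(2)[OF walk_hist[of d "\<lambda>k. X k \<omega>" m]] elim(2) by simp
        then have "{m. X m \<omega> = u} = {}" using False by auto
        then show ?thesis by simp
      qed
      ultimately show False using elim(1,2) by blast
    qed
  qed
qed

end

section \<open>Transience\<close>


text \<open>The base level is that of the parent of \<open>f\<close>. Without the factor 1 / P N of
  a hitting probability, the value at the first visit to \<open>f\<close> is 1 for each admissible
  \<open>N\<close>.\<close>

definition path_avg :: "nat \<Rightarrow> real \<Rightarrow> nat \<Rightarrow> nat list \<Rightarrow> nat list list \<Rightarrow> real" where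
  "path_avg d a N f h =
    (\<Sum>x\<in>descendants d f N. path_pot a (length f - 1) x h) / real (card (descendants d f N))"

definition pair_avg :: "nat \<Rightarrow> real \<Rightarrow> nat \<Rightarrow> nat list \<Rightarrow> nat list list \<Rightarrow> real" where
  "pair_avg d a N f h =
    (\<Sum>x\<in>descendants d f N. \<Sum>y\<in>descendants d f N.
      4 * real (meet x y - (length f - 1)) * pair_pot a (length f - 1) x y h) /
    (real (card (descendants d f N)))\<^sup>2"

text \<open>
  Since \<open>path_avg\<^sup>2 \<le> pair_avg\<close>, this is at most \<open>2 e W - (e W)\<^sup>2 \<le> 1\<close>; it vanishes at the parent of
  \<open>f\<close>, so being a martingale in between it bounds the escape probability from below.
\<close>

definition escape_bound :: "nat \<Rightarrow> real \<Rightarrow> nat \<Rightarrow> real \<Rightarrow> nat list \<Rightarrow> nat list list \<Rightarrow> real" where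
  "escape_bound d a N e f h = 2 * e * path_avg d a N f h - e\<^sup>2 * pair_avg d a N f h"

lemma meet_descendants:
  assumes "x \<in> descendants d f N" "y \<in> descendants d f N"
  shows "length f \<le> meet x y"
  using assms length_le_meet_iff[of f x y] by (auto simp: descendants_def)

lemma path_avg_square_le:
  assumes a: "a > 0" and h: "walk d h" and f: "f \<noteq> []" and r: "suffix (tl f) (hd h)"
  shows "(path_avg d a N f h)\<^sup>2 \<le> pair_avg d a N f h"
proof -
  let ?L = "descendants d f N" and ?l = "length f - 1"
  have "path_pot a ?l x h * path_pot a ?l y h \<le> 4 * real (meet x y - ?l) * pair_pot a ?l x y h"
    if xy: "x \<in> ?L" "y \<in> ?L" for x y
  proof (rule path_pot_mult_le[OF a h])
    have "suffix (tl f) z" if "z \<in> ?L" for z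
      using that suffix_order.trans[OF suffix_tl] by (auto simp: descendants_def)
    then have "?l \<le> meet z (hd h)" if "z \<in> ?L" for z
      using length_le_meet_iff[of "tl f" z "hd h"] r that by simp
    then show "?l \<le> meet x (hd h)" "?l \<le> meet y (hd h)" using xy by auto
    show "?l < meet x y" using meet_descendants[OF xy] f by (cases f) auto
  qed
  then have "(\<Sum>x\<in>?L. path_pot a ?l x h) * (\<Sum>x\<in>?L. path_pot a ?l x h) \<le>
      (\<Sum>x\<in>?L. \<Sum>y\<in>?L. 4 * real (meet x y - ?l) * pair_pot a ?l x y h)"
    unfolding sum_product by (intro sum_mono)
  then show ?thesis
    unfolding path_avg_def pair_avg_def power_divide
    by (intro divide_right_mono) (auto simp: power2_eq_square)
qed

lemma escape_bound_le_1:
  assumes a: "a > 0" and h: "walk d h" and f: "f \<noteq> []" and r: "suffix (tl f) (hd h)"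
  shows "escape_bound d a N e f h \<le> 1"
proof -
  have "e\<^sup>2 * (path_avg d a N f h)\<^sup>2 \<le> e\<^sup>2 * pair_avg d a N f h"
    using path_avg_square_le[OF assms] by (intro mult_left_mono) auto
  moreover have "0 \<le> (1 - e * path_avg d a N f h)\<^sup>2" by simp
  then have "2 * e * path_avg d a N f h - e\<^sup>2 * (path_avg d a N f h)\<^sup>2 \<le> 1"
    by (simp add: power2_eq_square algebra_simps)
  ultimately show ?thesis unfolding escape_bound_def by linarith
qed

lemma escape_bound_parent:
  assumes "hd h = tl f"
  shows "escape_bound d a N e f h = 0"
proof -
  have "meet x (tl f) = length f - 1" if "x \<in> descendants d f N" for x
    using that meet_eq_length[of "tl f" x] suffix_order.trans[OF suffix_tl]
    by (auto simp: descendants_def)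
  then show ?thesis
    by (simp add: escape_bound_def path_avg_def pair_avg_def path_pot_def pair_pot_def assms)
qed

lemma step_escape_bound:
  assumes a: "a > 0" and h: "walk d h" and f: "f \<noteq> []" "suffix f (hd h)"
    and N: "length (hd h) \<noteq> N"
  shows "step d a (escape_bound d a N e f) h = escape_bound d a N e f h"
proof -
  let ?L = "descendants d f N" and ?l = "length f - 1"
  have l: "?l < length (hd h)" using suffix_length_le[OF f(2)] f(1) by (cases f) auto
  have L: "x \<in> tree d" "?l < length x" "hd h \<noteq> x" if "x \<in> ?L" for x
    using that f(1) N suffix_length_le[of f x] by (cases f; auto simp: descendants_def)+
  have m: "?l < meet x y" if "x \<in> ?L" "y \<in> ?L" for x y
    using meet_descendants[OF that] f(1) by (cases f) auto
  have "step d a (\<lambda>h. \<Sum>x\<in>?L. path_pot a ?l x h) h = (\<Sum>x\<in>?L. path_pot a ?l x h)"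
    unfolding step_sum by (intro sum.cong refl step_path_pot a h L l)
  then have 1: "step d a (path_avg d a N f) h = path_avg d a N f h"
    unfolding path_avg_def divide_inverse mult.commute[of _ "inverse _"] step_cmult by simp
  have "step d a (\<lambda>h. \<Sum>x\<in>?L. \<Sum>y\<in>?L. 4 * real (meet x y - ?l) * pair_pot a ?l x y h) h =
      (\<Sum>x\<in>?L. \<Sum>y\<in>?L. 4 * real (meet x y - ?l) * pair_pot a ?l x y h)"
    unfolding step_sum step_cmult
    by (intro sum.cong refl arg_cong2[where f = "(*)"] step_pair_pot a h L l m)
  then have 2: "step d a (pair_avg d a N f) h = pair_avg d a N f h"
    unfolding pair_avg_def divide_inverse mult.commute[of _ "inverse _"] step_cmult by simp
  show ?thesis unfolding escape_bound_def step_diff step_cmult 1 2 ..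
qed

section \<open>Values at the first visit to a vertex\<close>

lemma fresh_depth:
  assumes h: "walk d (f # g)" and f: "f \<notin> set g" "f \<noteq> []" and x: "suffix f x"
  shows "depth x (set (f # g)) = length f"
proof (rule antisym)
  from h have g: "walk d g" by cases (use f in auto)
  show "depth x (set (f # g)) \<le> length f"
  proof (rule depth_le)
    fix v assume "v \<in> set (f # g)"
    moreover have "meet x v \<le> length f" if v: "v \<in> set g"
      using length_le_meet_iff[OF x, of v] walk_suffix_closed[OF g v, of f] f(1) by linarith
    ultimately show "meet x v \<le> length f" using meet_le[of x v] by auto
  qed auto
  show "length f \<le> depth x (set (f # g))"
    using meet_le_depth[of "set (f # g)" f x] meet_eq_length[OF x] by simp
qed

text \<open>Dyadic splitting by the size of \<open>meet x y\<close>. The \<open>y\<close> with value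
  at least \<open>2 ^ j\<close> descend from the ancestor of \<open>x\<close> at level
  \<open>2 ^ j\<close>, so there are at most \<open>d ^ (K - j)\<close> of them; rounding up to the
  next power of two gives the exponent \<open>Suc j\<close>.\<close>

lemma dyadic_sum_meet:
  assumes x: "x \<in> descendants d f (2 ^ K)" and f: "length f = Suc (2 ^ k)" and a: "a > 0"
  shows "(\<Sum>y\<in>descendants d f (2 ^ K). real (meet x y) powr a) \<le>
    (\<Sum>j=k..K. (2 powr a) ^ Suc j * real d ^ (K - j))"
proof -
  let ?L = "descendants d f (2 ^ K)"
  have ft: "f \<in> tree d" using x tree_suffix by (auto simp: descendants_def)
  have fin: "finite ?L" by (rule finite_descendants[OF ft])
  have pw: "(2 powr a) ^ j = real (2 ^ j) powr a" for j
    by (simp add: powr_realpow[symmetric] powr_powr mult.commute)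
  have "real (meet x y) powr a \<le> (\<Sum>j=k..K. of_bool (2 ^ j \<le> meet x y) * (2 powr a) ^ Suc j)"
    if y: "y \<in> ?L" for y
  proof -
    have M: "Suc (2 ^ k) \<le> meet x y" using meet_descendants[OF x y] f by simp
    then obtain j where j: "2 ^ j \<le> meet x y" "meet x y < 2 ^ (j + 1)"
      using ex_power_ivl1[of 2 "meet x y"] by auto
    have "2 ^ k < (2 :: nat) ^ (j + 1)" using M j(2) by linarith
    then have "k < j + 1" by (rule power_less_imp_less_exp[rotated]) simp
    moreover have "meet x y \<le> 2 ^ K" using meet_le'[of x y] x by (simp add: descendants_def)
    then have "(2 :: nat) ^ j \<le> 2 ^ K" using j(1) by linarith
    then have "j \<le> K" by (rule power_le_imp_le_exp[rotated]) simp
    ultimately have jk: "j \<in> {k..K}" by simp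
    have "real (meet x y) powr a \<le> (2 powr a) ^ Suc j"
    proof -
      have "meet x y \<le> 2 ^ Suc j" using j(2) by simp
      then have "real (meet x y) \<le> real (2 ^ Suc j)" by (rule of_nat_mono)
      then show ?thesis unfolding pw using a by (intro powr_mono2) auto
    qed
    also have "\<dots> = of_bool (2 ^ j \<le> meet x y) * (2 powr a) ^ Suc j" using j(1) by simp
    also have "\<dots> \<le> (\<Sum>j=k..K. of_bool (2 ^ j \<le> meet x y) * (2 powr a) ^ Suc j)"
      by (rule member_le_sum[OF jk]) auto
    finally show ?thesis .
  qed
  then have "(\<Sum>y\<in>?L. real (meet x y) powr a) \<le>
      (\<Sum>y\<in>?L. \<Sum>j=k..K. of_bool (2 ^ j \<le> meet x y) * (2 powr a) ^ Suc j)"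
    by (rule sum_mono)
  also have "\<dots> = (\<Sum>j=k..K. \<Sum>y\<in>?L. of_bool (2 ^ j \<le> meet x y) * (2 powr a) ^ Suc j)"
    by (rule sum.swap)
  also have "\<dots> = (\<Sum>j=k..K. (2 powr a) ^ Suc j * real (card {y\<in>?L. 2 ^ j \<le> meet x y}))"
    using fin by (intro sum.cong refl) (simp flip: sum_distrib_right add: Int_def)
  also have "\<dots> \<le> (\<Sum>j=k..K. (2 powr a) ^ Suc j * real d ^ (K - j))"
  proof (intro sum_mono mult_left_mono)
    fix j assume j: "j \<in> {k..K}"
    define z where "z = drop (length x - 2 ^ j) x"
    have lx: "length x = 2 ^ K" "x \<in> tree d" using x by (auto simp: descendants_def)
    have z: "suffix z x" by (simp add: z_def suffix_drop)
    have lz: "length z = 2 ^ j" using lx j by (simp add: z_def)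
    have zt: "z \<in> tree d" using tree_suffix[OF lx(2) z] .
    have "{y\<in>?L. 2 ^ j \<le> meet x y} \<subseteq> descendants d z (2 ^ K)"
      using length_le_meet_iff[OF z] lz by (auto simp: descendants_def)
    then have "card {y\<in>?L. 2 ^ j \<le> meet x y} \<le> card (descendants d z (2 ^ K))"
      by (intro card_mono finite_descendants[OF zt])
    also have "\<dots> = d ^ (K - j)" using card_descendants_dyadic[OF zt lz] j by simp
    finally show "real (card {y\<in>?L. 2 ^ j \<le> meet x y}) \<le> real d ^ (K - j)"
      by (metis of_nat_le_iff of_nat_power)
  qed auto
  finally show ?thesis .
qed

text \<open>Used with \<tau> = \<open>2 powr a\<close> and \<open>D = d\<close>. The ratio \<tau> /
  D is below 1, so the sum is of the order of its term \<open>j = k\<close>;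
  \<open>D ^ (K - Suc k)\<close> is the number of descendants of \<open>f\<close>, which later
  cancels.\<close>

lemma geometric_sum_le:
  assumes \<tau>: "0 < \<tau>" "\<tau> < D" and k: "k < K"
  shows "(\<Sum>j=k..K. \<tau> ^ Suc j * D ^ (K - j)) \<le>
    (D * \<tau> / (1 - \<tau> / D)) * \<tau> ^ k * (D :: real) ^ (K - Suc k)"
proof -
  define \<beta> where "\<beta> = \<tau> / D"
  have D: "D > 0" using \<tau> by linarith
  have \<beta>: "0 < \<beta>" "\<beta> < 1" using \<tau> D by (auto simp: \<beta>_def)
  have summand: "\<tau> ^ Suc j * D ^ (K - j) = \<tau> * D ^ K * \<beta> ^ j" if "j \<le> K" for j
    using D that by (simp add: \<beta>_def power_divide power_diff)
  have "(\<Sum>j=k..K. \<tau> ^ Suc j * D ^ (K - j)) = \<tau> * D ^ K * (\<Sum>j=k..K. \<beta> ^ j)"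
    unfolding sum_distrib_left using summand by (intro sum.cong) auto
  also have "(\<Sum>j=k..K. \<beta> ^ j) \<le> \<beta> ^ k / (1 - \<beta>)"
    using k \<beta> by (subst sum_gp) (auto simp: divide_right_mono)
  also have "\<tau> * D ^ K * (\<beta> ^ k / (1 - \<beta>)) = (D * \<tau> / (1 - \<beta>)) * \<tau> ^ k * D ^ (K - Suc k)"
  proof -
    have "D ^ K = D ^ (K - Suc k) * D * D ^ k"
      using k by (simp flip: power_add power_Suc2 add: Suc_diff_Suc)
    then have "D ^ K * \<beta> ^ k = D ^ (K - Suc k) * D * \<tau> ^ k"
      using D by (simp add: \<beta>_def power_divide)
    then show ?thesis by (simp add: field_simps)
  qed
  finally show ?thesis using \<tau> D by (simp add: \<beta>_def mult_left_mono)
qed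

text \<open>The left side equals \<open>2 * (esc_prod a (2 * b))\<^sup>2 / esc_prod a b\<close>, the
  square of a quantity of order \<open>b powr a\<close> divided by another of that order.\<close>

lemma pair_slope_fresh_le:
  assumes a: "a > 0" and c: "c > 0" "C > 0"
    and lo: "\<And>n. n \<ge> 1 \<Longrightarrow> c * real n powr a \<le> esc_prod a n"
    and up: "\<And>n. n \<ge> 1 \<Longrightarrow> esc_prod a n \<le> C * real n powr a"
    and b: "b \<ge> 1"
  shows "8 * real b * pair_slope a b 1 1 \<le> (2 * C\<^sup>2 * 4 powr a / c) * real b powr a"
proof -
  have P: "esc_prod a n > 0" for n using esc_prod_ge_1[OF a, of n] by linarith
  have "slope a 1 = 1" by (simp add: slope_def esc_prod_def)
  then have "8 * real b * pair_slope a b 1 1 = 2 * (esc_prod a (2 * b))\<^sup>2 / esc_prod a b"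
    using b P[of b] by (simp add: pair_slope_def max_absorb2 min_absorb1 slope_def power2_eq_square
        field_simps mult_2[symmetric])
  also have "\<dots> \<le> 2 * (C * real (2 * b) powr a)\<^sup>2 / (c * real b powr a)"
    using up[of "2 * b"] lo[of b] P[of "2 * b"] b c
    by (intro frac_le mult_left_mono power_mono) (auto simp: less_imp_le)
  also have "(C * real (2 * b) powr a)\<^sup>2 = C\<^sup>2 * 4 powr a * (real b powr a)\<^sup>2"
  proof -
    have "4 powr a = (2 powr a)\<^sup>2" by (simp add: power2_eq_square flip: powr_mult)
    then show ?thesis by (simp add: powr_mult power_mult_distrib)
  qed
  also have "2 * (C\<^sup>2 * 4 powr a * (real b powr a)\<^sup>2) / (c * real b powr a) =
      (2 * C\<^sup>2 * 4 powr a / c) * real b powr a"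
    using b c by (simp add: power2_eq_square field_simps)
  finally show ?thesis .
qed

lemma escape_bound_fresh:
  assumes a: "a > 0" and da: "2 powr a < real d"
  obtains C where "C \<ge> 1"
    "\<And>k K f g. k < K \<Longrightarrow> f \<in> tree d \<Longrightarrow> length f = Suc (2 ^ k) \<Longrightarrow> walk d (f # g) \<Longrightarrow> f \<notin> set g \<Longrightarrow>
      1 / (C * (2 powr a) ^ k) \<le> escape_bound d a (2 ^ K) (1 / (C * (2 powr a) ^ k)) f (f # g)"
proof -
  obtain c0 C0 where c: "c0 > 0" "C0 > 0"
    and lo: "\<And>n. n \<ge> 1 \<Longrightarrow> c0 * real n powr a \<le> esc_prod a n"
    and up: "\<And>n. n \<ge> 1 \<Longrightarrow> esc_prod a n \<le> C0 * real n powr a"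
    using esc_prod_bounds[OF a] by metis
  \<comment> \<open>\<open>C1\<close> compares the contribution of a pair with
    \<open>meet x y powr a\<close>, \<open>C2\<close> is the constant of
    \<open>geometric_sum_le\<close>, and the maximum with 1 in \<open>C\<close> will keep the
    success probability at most 1.\<close>
  define C1 where "C1 = 2 * C0\<^sup>2 * 4 powr a / c0"
  define C2 where "C2 = real d * 2 powr a / (1 - 2 powr a / real d)"
  define C where "C = max 1 (C1 * C2)"
  have C1: "C1 > 0" using c by (simp add: C1_def)
  have d0: "d \<ge> 1" using da by (cases d) auto
  show thesis
  proof (rule that)
    show "C \<ge> 1" by (simp add: C_def)
    fix k K :: nat and f g
    assume k: "k < K" and f: "f \<in> tree d" "length f = Suc (2 ^ k)" "f \<notin> set g"
      and h: "walk d (f # g)"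
    let ?L = "descendants d f (2 ^ K)" and ?l = "2 ^ k :: nat" and ?h = "f # g"
    let ?e = "1 / (C * (2 powr a) ^ k)"
    have fn: "f \<noteq> []" using f(2) by auto
    have card: "card ?L = d ^ (K - Suc k)" by (rule card_descendants_Suc_dyadic[OF f(1,2) k d0])
    then have card0: "real (card ?L) > 0" using d0 by simp
    have x: "meet x f = Suc ?l" "depth x (set ?h) = Suc ?l" if "x \<in> ?L" for x
      using that meet_eq_length[of f x] fresh_depth[OF h f(3) fn, of x] f(2)
      by (auto simp: descendants_def)
    have "path_pot a ?l x ?h = 1" if "x \<in> ?L" for x
    proof -
      have "path_pot a ?l x ?h = (real (Suc ?l) - real ?l) * slope a (Suc ?l - ?l)"
        unfolding path_pot_def x(2)[OF that] using x(1)[OF that] by simp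
      then show ?thesis by (simp add: slope_def esc_prod_def Suc_diff_le)
    qed
    then have avg: "path_avg d a (2 ^ K) f ?h = 1"
      using card0 f(2) by (simp add: path_avg_def)
    have "4 * real (meet x y - ?l) * pair_pot a ?l x y ?h \<le> C1 * real (meet x y) powr a"
      if xy: "x \<in> ?L" "y \<in> ?L" for x y
    proof -
      define b where "b = meet x y - ?l"
      have b1: "b \<ge> 1" using meet_descendants[OF xy] f(2) by (simp add: b_def)
      have "pair_pot a ?l x y ?h =
          (real (Suc ?l) + real (Suc ?l) - 2 * real ?l) * pair_slope a b (Suc ?l - ?l) (Suc ?l - ?l)"
        unfolding pair_pot_def x(2)[OF xy(1)] x(2)[OF xy(2)] b_def
        using x(1)[OF xy(1)] x(1)[OF xy(2)] by simp
      then have "pair_pot a ?l x y ?h = 2 * pair_slope a b 1 1" by (simp add: Suc_diff_le)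
      then have "4 * real (meet x y - ?l) * pair_pot a ?l x y ?h = 8 * real b * pair_slope a b 1 1"
        by (simp add: b_def)
      also have "\<dots> \<le> C1 * real b powr a"
        unfolding C1_def by (rule pair_slope_fresh_le[OF a c lo up b1])
      also have "\<dots> \<le> C1 * real (meet x y) powr a"
        using C1 a by (intro mult_left_mono powr_mono2) (auto simp: b_def)
      finally show ?thesis .
    qed
    then have "(\<Sum>x\<in>?L. \<Sum>y\<in>?L. 4 * real (meet x y - ?l) * pair_pot a ?l x y ?h) \<le>
        (\<Sum>x\<in>?L. \<Sum>y\<in>?L. C1 * real (meet x y) powr a)"
      by (intro sum_mono)
    also have "\<dots> = C1 * (\<Sum>x\<in>?L. \<Sum>y\<in>?L. real (meet x y) powr a)"
      by (simp add: sum_distrib_left)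
    also have "\<dots> \<le> C1 * (\<Sum>x\<in>?L. C2 * (2 powr a) ^ k * real (card ?L))"
    proof (intro mult_left_mono sum_mono)
      fix x assume "x \<in> ?L"
      from dyadic_sum_meet[OF this f(2) a]
      show "(\<Sum>y\<in>?L. real (meet x y) powr a) \<le> C2 * (2 powr a) ^ k * real (card ?L)"
        using geometric_sum_le[of "2 powr a" "real d" k K] da k by (simp add: C2_def card)
    qed (use C1 in auto)
    also have "\<dots> = C1 * C2 * (2 powr a) ^ k * (real (card ?L))\<^sup>2"
      by (simp add: power2_eq_square)
    finally have "pair_avg d a (2 ^ K) f ?h \<le> C1 * C2 * (2 powr a) ^ k"
      using card0 f(2) by (simp add: pair_avg_def divide_le_eq)
    also have "\<dots> \<le> C * (2 powr a) ^ k" by (intro mult_right_mono) (auto simp: C_def)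
    finally have G: "pair_avg d a (2 ^ K) f ?h \<le> C * (2 powr a) ^ k" .
    have pos: "C * (2 powr a) ^ k > 0" by (simp add: C_def)
    have "?e\<^sup>2 * pair_avg d a (2 ^ K) f ?h \<le> ?e\<^sup>2 * (C * (2 powr a) ^ k)"
      using G by (intro mult_left_mono) auto
    also have "\<dots> = ?e" using pos by (simp add: power2_eq_square)
    finally show "?e \<le> escape_bound d a (2 ^ K) ?e f ?h"
      unfolding escape_bound_def avg by linarith
  qed
qed

text \<open>The walk has stayed in the subtree of \<open>f\<close> since its very first visit there.
  Later excursions are excluded because the estimate of \<open>escape_bound_fresh\<close> starts
  from an unexplored subtree.\<close>

primrec first_excursion :: "nat list \<Rightarrow> nat list list \<Rightarrow> bool" where
  "first_excursion f [] \<longleftrightarrow> False"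
| "first_excursion f (y # h) \<longleftrightarrow> y = f \<and> f \<notin> set h \<or> suffix f y \<and> first_excursion f h"

lemma first_excursion_suffix: "first_excursion f h \<Longrightarrow> suffix f (hd h)"
  by (cases h) auto

definition ancestor :: "nat \<Rightarrow> 'b list \<Rightarrow> 'b list" where
  "ancestor n p = drop (length p - n) p"

lemma ancestor_eq: "suffix f p \<Longrightarrow> length f = n \<Longrightarrow> ancestor n p = f"
  by (auto simp: ancestor_def suffix_def)

text \<open>
  A supermartingale that starts at \<open>(1 - e) ^ card F\<close>, where \<open>F\<close> is level \<open>l + 1\<close>, and equals 1
  once all of \<open>F\<close> has been visited and the walk is back at the root.
\<close>

definition attempts :: "nat \<Rightarrow> real \<Rightarrow> nat \<Rightarrow> nat \<Rightarrow> real \<Rightarrow> nat list list \<Rightarrow> real" where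
  "attempts d a N l e h = (1 - e) ^ card (descendants d [] (Suc l) - set h) *
    (if l < length (hd h) \<and> first_excursion (ancestor (Suc l) (hd h)) h
     then 1 - escape_bound d a N e (ancestor (Suc l) (hd h)) h else 1)"

lemma suffix_parent: "suffix f p \<Longrightarrow> suffix (tl f) p"
  using suffix_order.trans[OF suffix_tl] by blast

lemma attempts_nonneg:
  assumes a: "a > 0" and e: "e \<le> 1" and h: "walk d h"
  shows "0 \<le> attempts d a N l e h"
proof -
  let ?f = "ancestor (Suc l) (hd h)"
  have "escape_bound d a N e ?f h \<le> 1" if "l < length (hd h)"
  proof (rule escape_bound_le_1[OF a h])
    show "?f \<noteq> []" using that by (auto simp: ancestor_def)
    show "suffix (tl ?f) (hd h)" by (rule suffix_parent) (simp add: ancestor_def suffix_drop)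
  qed
  then show ?thesis using e by (auto simp: attempts_def)
qed

text \<open>The mean is unchanged inside a first excursion, and the value does not change elsewhere
  except on entering a fresh vertex of level \<open>l + 1\<close>, where it cannot increase.\<close>

lemma step_attempts:
  assumes a: "a > 0" and e: "e \<le> 1" and h: "walk d h" and N: "length (hd h) \<noteq> N"
    and fresh: "\<And>f g. f \<in> tree d \<Longrightarrow> length f = Suc l \<Longrightarrow> walk d (f # g) \<Longrightarrow> f \<notin> set g \<Longrightarrow>
      e \<le> escape_bound d a N e f (f # g)"
  shows "step d a (attempts d a N l e) h \<le> attempts d a N l e h"
proof (cases "l < length (hd h)")
  case True
  define p where "p = hd h"
  define f where "f = ancestor (Suc l) p"
  define u where "u = (1 - e) ^ card (descendants d [] (Suc l) - set h)"
  have f: "suffix f p" "length f = Suc l" "f \<noteq> []"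
    using True by (auto simp: f_def ancestor_def suffix_drop p_def)
  have fV: "f \<in> set h" using walk_suffix_closed[OF h walk_hd(1)[OF h]] f(1) by (simp add: p_def)
  \<comment> \<open>From inside a subtree a fresh vertex is a child of the current position, hence
    of level above \<open>Suc l\<close>, so no further subtree is discovered.\<close>
  have U: "descendants d [] (Suc l) - set (q # h) = descendants d [] (Suc l) - set h"
    if "adj d (hd h) q" for q
  proof -
    have "q \<in> set h" if "length q = Suc l"
      by (rule ccontr, rule unvisited_neighbour[OF h \<open>adj d (hd h) q\<close>]) (use that True in auto)
    then have "q \<notin> descendants d [] (Suc l) \<or> q \<in> set h" by (auto simp: descendants_def)
    then show ?thesis by auto
  qed
  have q: "suffix f q \<and> ancestor (Suc l) q = f \<and> l < length q \<or> q = tl f \<and> \<not> l < length q"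
    if "adj d (hd h) q" for q
  proof -
    from that consider i where "q = i # p" | i where "p = i # q" by (auto simp: adj_def p_def)
    then show ?thesis
    proof cases
      case 1
      then have "suffix f q" using f(1) by (simp add: suffix_ConsI)
      then show ?thesis using ancestor_eq[OF _ f(2)] suffix_length_le[of f q] f(2) by auto
    next
      case 2
      show ?thesis
      proof (cases "f = p")
        case True
        then show ?thesis using 2 f(2) by auto
      next
        case False
        then have "suffix f q" using f(1) 2 by (auto simp: suffix_Cons)
        then show ?thesis using ancestor_eq[OF _ f(2)] suffix_length_le[of f q] f(2) by auto
      qed
    qed
  qed
  show ?thesis
  proof (cases "first_excursion f h")
    case ex: True
    \<comment> \<open>The formula also covers the exit: at the parent of \<open>f\<close> the
      \<open>escape_bound\<close> is zero, matching the value 1 of the other branch.\<close>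
    have "step d a (attempts d a N l e) h = step d a (\<lambda>g. u * (1 - escape_bound d a N e f g)) h"
    proof (rule step_cong)
      fix q assume adj: "adj d (hd h) q"
      show "attempts d a N l e (q # h) = u * (1 - escape_bound d a N e f (q # h))"
        using q[OF adj] ex escape_bound_parent[of "q # h" f d a N e]
        unfolding attempts_def U[OF adj] u_def by auto
    qed
    also have "\<dots> = u * (1 - escape_bound d a N e f h)"
      using step_escape_bound[OF a h f(3) _ N] f(1)
      by (simp add: step_cmult step_diff step_const[OF a h] p_def)
    also have "\<dots> = attempts d a N l e h"
      using ex True by (simp add: attempts_def u_def f_def p_def)
    finally show ?thesis by simp
  next
    case ex: False
    have "step d a (attempts d a N l e) h = step d a (\<lambda>g. u) h"
    proof (rule step_cong)
      fix q assume adj: "adj d (hd h) q"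
      show "attempts d a N l e (q # h) = u"
        using q[OF adj] ex fV unfolding attempts_def U[OF adj] u_def by auto
    qed
    also have "\<dots> = attempts d a N l e h"
      using ex step_const[OF a h] by (simp add: attempts_def u_def f_def p_def)
    finally show ?thesis by simp
  qed
next
  case False
  have "step d a (attempts d a N l e) h \<le> step d a (\<lambda>g. attempts d a N l e h) h"
  proof (rule step_mono[OF a])
    fix q assume adj: "adj d (hd h) q"
    let ?F = "descendants d [] (Suc l)"
    have h0: "attempts d a N l e h = (1 - e) ^ card (?F - set h)"
      using False by (simp add: attempts_def)
    show "attempts d a N l e (q # h) \<le> attempts d a N l e h"
    proof (cases "l < length q")
      case lq: True
      then obtain i where "q = i # hd h" using adj False by (auto simp: adj_def)
      then have len: "length q = Suc l" using False lq by auto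
      then have anc: "ancestor (Suc l) q = q" by (simp add: ancestor_def)
      have qt: "q \<in> tree d" using adj by (simp add: adj_def)
      then have qF: "q \<in> ?F" using len by (simp add: descendants_def)
      show ?thesis
      proof (cases "q \<in> set h")
        case True
        then have "set (q # h) = set h" by auto
        moreover have "\<not> first_excursion q h"
          using first_excursion_suffix[of q h] suffix_length_le[of q "hd h"] lq False by linarith
        ultimately show ?thesis unfolding h0 using True by (simp add: attempts_def anc)
      next
        case nq: False
        \<comment> \<open>A first visit to \<open>q\<close> trades one factor \<open>1 - e\<close>
          for \<open>1 - escape_bound\<close>, which is no larger by \<open>fresh\<close>.\<close>
        have fin: "finite (?F - set h)" using finite_descendants[OF tree.root] by auto
        have "?F - set (q # h) = (?F - set h) - {q}" by auto
        then have card: "card (?F - set h) = Suc (card (?F - set (q # h)))"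
          using card.remove[OF fin, of q] qF nq by simp
        have "e \<le> escape_bound d a N e q (q # h)"
          by (rule fresh[OF qt len walk_step[OF h adj] nq])
        then have "(1 - e) ^ card (?F - set (q # h)) * (1 - escape_bound d a N e q (q # h)) \<le>
            (1 - e) ^ card (?F - set (q # h)) * (1 - e)"
          using e by (intro mult_left_mono) auto
        then show ?thesis unfolding h0 card using nq lq
          by (simp add: attempts_def anc mult.commute del: list.set)
      qed
    next
      case lq: False
      then have "?F - set (q # h) = ?F - set h" by (auto simp: descendants_def)
      then show ?thesis unfolding h0 using lq by (simp add: attempts_def del: list.set)
    qed
  qed
  then show ?thesis using step_const[OF a h] by simp
qed

section \<open>Returning to the root after entering every subtree\<close>

context orrw
begin

lemma prob_return_bounded:
  assumes a: "a > 0" and e: "e \<le> 1"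
    and fresh: "\<And>f g. f \<in> tree d \<Longrightarrow> length f = Suc l \<Longrightarrow> walk d (f # g) \<Longrightarrow> f \<notin> set g \<Longrightarrow>
      e \<le> escape_bound d a N e f (f # g)"
  shows "prob {\<omega> \<in> space M. \<exists>s.
    (descendants d [] (Suc l) \<subseteq> set (HX (0 + s) \<omega>) \<and> hd (HX (0 + s) \<omega>) = []) \<and>
    (\<forall>r<s. \<not> length (hd (HX (0 + r) \<omega>)) = N)} \<le> (1 - e) ^ card (descendants d [] (Suc l))"
proof -
  let ?F = "descendants d [] (Suc l)"
  have "prob {\<omega> \<in> space M. \<exists>s.
      (?F \<subseteq> set (HX (0 + s) \<omega>) \<and> hd (HX (0 + s) \<omega>) = []) \<and>
      (\<forall>r<s. \<not> length (hd (HX (0 + r) \<omega>)) = N)} \<le> walk_exp 0 (attempts d a N l e)"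
  proof (rule prob_hit[where I = "\<lambda>_. True"])
    fix h :: "nat list list" assume h: "walk d h"
    show "0 \<le> attempts d a N l e h" by (rule attempts_nonneg[OF a e h])
    show "1 \<le> attempts d a N l e h" if A: "?F \<subseteq> set h \<and> hd h = []"
    proof -
      have "?F - set h = {}" using A by auto
      then show ?thesis unfolding attempts_def using A by (simp only: card.empty) simp
    qed
    show "step d a (attempts d a N l e) h \<le> attempts d a N l e h" if "length (hd h) \<noteq> N"
      by (rule step_attempts[OF a e h that fresh])
  qed (use a in auto)
  also have "\<dots> \<le> walk_exp 0 (\<lambda>h. (1 - e) ^ card ?F)"
  proof (rule walk_exp_mono)
    fix h :: "nat list list" assume h: "walk d h" "length h = Suc 0"
    from h(1) have "h = [[]]" by cases (use h(2) walk_not_Nil in auto)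
    moreover have "[] \<notin> ?F" by (simp add: descendants_def)
    ultimately show "attempts d a N l e h \<le> (1 - e) ^ card ?F" by (simp add: attempts_def)
  qed
  finally show ?thesis by (simp add: walk_exp_const)
qed

text \<open>Removes the cutoff level: up to time \<open>t\<close> the walk cannot reach level
  \<open>2 ^ (k + t + 1)\<close>, and the bound does not depend on that level, so \<open>t\<close>
  may tend to infinity.\<close>

lemma prob_return:
  assumes a: "a > 0" and e: "e \<le> 1"
    and fresh: "\<And>K f g. k < K \<Longrightarrow> f \<in> tree d \<Longrightarrow> length f = Suc l \<Longrightarrow> walk d (f # g) \<Longrightarrow> f \<notin> set g \<Longrightarrow>
      e \<le> escape_bound d a (2 ^ K) e f (f # g)"
  shows "prob {\<omega> \<in> space M. \<exists>s. descendants d [] (Suc l) \<subseteq> set (HX s \<omega>) \<and> hd (HX s \<omega>) = []} \<le>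
    (1 - e) ^ card (descendants d [] (Suc l))"
proof -
  let ?F = "descendants d [] (Suc l)"
  define E where "E t = {\<omega> \<in> space M. \<exists>s\<le>t. ?F \<subseteq> set (HX s \<omega>) \<and> hd (HX s \<omega>) = []}" for t
  note [measurable] = measurable_hist_pred[of "\<lambda>h. ?F \<subseteq> set h \<and> hd h = []"]
  have meas: "E t \<in> sets M" for t unfolding E_def by measurable
  have le: "prob (E t) \<le> (1 - e) ^ card ?F" for t
  proof -
    let ?N = "2 ^ (k + t + 1) :: nat"
    let ?G = "{\<omega> \<in> space M. \<exists>s.
      (?F \<subseteq> set (HX (0 + s) \<omega>) \<and> hd (HX (0 + s) \<omega>) = []) \<and>
      (\<forall>r<s. \<not> length (hd (HX (0 + r) \<omega>)) = ?N)}"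
    have tN: "t < ?N" by (rule less_le_trans[OF less_exp], rule power_increasing) auto
    have "prob (E t) \<le> prob ?G"
    proof (rule finite_measure_mono_AE)
      show "AE \<omega> in M. \<omega> \<in> E t \<longrightarrow> \<omega> \<in> ?G"
        using AE_tree_path
      proof eventually_elim
        case (elim \<omega>)
        have len: "length (X r \<omega>) \<noteq> ?N" if "r \<le> t" for r
        proof -
          have "length (X r \<omega>) < Suc r"
            using walk_length_le[OF walk_hist[OF elim, of r], of "X r \<omega>"] by auto
          then show ?thesis using that tN by linarith
        qed
        show ?case
        proof
          assume "\<omega> \<in> E t"
          then obtain s where s: "\<omega> \<in> space M" "s \<le> t" "?F \<subseteq> set (HX s \<omega>)" "hd (HX s \<omega>) = []"
            unfolding E_def by blast
          have "\<forall>r<s. \<not> length (hd (HX r \<omega>)) = ?N" using len s(2) by simp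
          then show "\<omega> \<in> ?G" using s(1,3,4) unfolding add_0 by blast
        qed
      qed
      show "?G \<in> sets M" by measurable
    qed
    also have "\<dots> \<le> (1 - e) ^ card ?F"
      by (rule prob_return_bounded[OF a e], rule fresh) auto
    finally show ?thesis .
  qed
  have "range E \<subseteq> sets M" using meas by auto
  moreover have "incseq E" by (rule incseq_SucI) (unfold E_def, blast intro: le_SucI)
  ultimately have "(\<lambda>t. prob (E t)) \<longlonglongrightarrow> prob (\<Union>t. E t)"
    by (rule finite_Lim_measure_incseq)
  then have "prob (\<Union>t. E t) \<le> (1 - e) ^ card ?F" by (rule LIMSEQ_le_const2) (use le in auto)
  moreover have "(\<Union>t. E t) = {\<omega> \<in> space M. \<exists>s. ?F \<subseteq> set (HX s \<omega>) \<and> hd (HX s \<omega>) = []}"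
    unfolding E_def by blast
  ultimately show ?thesis by simp
qed

lemma AE_not_all_infinitely_often:
  assumes a: "a > 0" and da: "2 powr a < real d"
  shows "AE \<omega> in M. \<not> (\<forall>u\<in>tree d. infinite {m. X m \<omega> = u})"
proof -
  obtain C where C: "C \<ge> 1"
    and fresh: "\<And>k K f g. k < K \<Longrightarrow> f \<in> tree d \<Longrightarrow> length f = Suc (2 ^ k) \<Longrightarrow> walk d (f # g) \<Longrightarrow> f \<notin> set g \<Longrightarrow>
      1 / (C * (2 powr a) ^ k) \<le> escape_bound d a (2 ^ K) (1 / (C * (2 powr a) ^ k)) f (f # g)"
    using escape_bound_fresh[OF a da] by metis
  define e where "e k = 1 / (C * (2 powr a) ^ k)" for k
  define \<rho> where "\<rho> = real d / 2 powr a"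
  have \<rho>: "\<rho> > 1" using da by (simp add: \<rho>_def)
  have d0: "real d > 0" using da powr_gt_zero[of 2 a] by linarith
  have e1: "e k \<le> 1" for k
  proof -
    have "1 \<le> (2 powr a) ^ k" using a by (intro one_le_power ge_one_powr_ge_zero) auto
    then have "1 * 1 \<le> C * (2 powr a) ^ k" using C by (intro mult_mono) auto
    then show ?thesis by (simp add: e_def divide_le_eq)
  qed
  show ?thesis
  proof (rule AE_not_if_bounds)
    fix k :: nat
    let ?F = "descendants d [] (Suc (2 ^ k))"
    let ?E = "{\<omega> \<in> space M. \<exists>s. ?F \<subseteq> set (HX s \<omega>) \<and> hd (HX s \<omega>) = []}"
    note [measurable] = measurable_hist_pred[of "\<lambda>h. ?F \<subseteq> set h \<and> hd h = []"]
    show "?E \<in> sets M" by measurable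
    have "prob ?E \<le> (1 - e k) ^ card ?F"
      by (rule prob_return[OF a e1, of k]) (use fresh e_def in simp)
    \<comment> \<open>With \<rho> = \<open>d / 2 powr a\<close> above 1, the number of attempts
      \<open>d ^ Suc k\<close> times \<open>e k\<close> is \<open>d / C\<close> times the k-th power
      of \<rho>, which tends to infinity.\<close>
    also have "\<dots> \<le> exp (- e k) ^ card ?F"
      using e1[of k] exp_ge_add_one_self[of "- e k"] by (intro power_mono) auto
    also have "\<dots> = exp (- (real d / C * \<rho> ^ k))"
      by (simp add: card_level_Suc e_def \<rho>_def power_divide flip: exp_of_nat_mult)
    finally show "prob ?E \<le> exp (- (real d / C * \<rho> ^ k))" .
    fix \<omega> assume \<omega>: "\<omega> \<in> space M" and io: "\<forall>u\<in>tree d. infinite {m. X m \<omega> = u}"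
    have "\<exists>t. X t \<omega> = f" if "f \<in> ?F" for f
    proof -
      have "infinite {m. X m \<omega> = f}" using io that by (simp add: descendants_def)
      then show ?thesis by (rule not_finite_existsD)
    qed
    then obtain t where t: "\<And>f. f \<in> ?F \<Longrightarrow> X (t f) \<omega> = f" by metis
    have fin: "finite ?F" by (intro finite_descendants tree.root)
    have "infinite {m. X m \<omega> = []}" using io tree.root by blast
    then obtain s where s: "Max (insert 0 (t ` ?F)) \<le> s" "X s \<omega> = []"
      unfolding infinite_nat_iff_unbounded_le by blast
    have "?F \<subseteq> set (HX s \<omega>)"
    proof
      fix f assume f: "f \<in> ?F"
      then have "t f \<le> Max (insert 0 (t ` ?F))" using fin by (intro Max_ge) auto
      then have "t f \<in> {..s}" using s(1) by simp
      with t[OF f, symmetric] have "f \<in> (\<lambda>k. X k \<omega>) ` {..s}" by (rule image_eqI)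
      then show "f \<in> set (HX s \<omega>)" by simp
    qed
    then show "\<omega> \<in> ?E" using \<omega> s(2) by auto
  next
    have "filterlim (\<lambda>k. \<rho> ^ k) at_top sequentially"
      using \<rho> by (intro filterlim_at_infinity_imp_filterlim_at_top
          filterlim_realpow_sequentially_gt1) auto
    then have "filterlim (\<lambda>k. real d / C * \<rho> ^ k) at_top sequentially"
      using d0 C by (intro filterlim_tendsto_pos_mult_at_top[OF tendsto_const]) auto
    then show "(\<lambda>k. exp (- (real d / C * \<rho> ^ k))) \<longlonglongrightarrow> 0"
      by (intro filterlim_compose[OF exp_at_bot] filterlim_compose[OF filterlim_uminus_at_bot_at_top])
  qed
qed

lemma transient:
  assumes a: "a > 0" and da: "2 powr a < real d"
  shows "as_transient d M X"
  unfolding as_transient_def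
  using AE_not_all_infinitely_often[OF assms] AE_infinitely_often[OF a]
  by eventually_elim blast

end

theorem theorem1:
  fixes d :: nat and a :: real and M :: "'w measure" and X :: "nat \<Rightarrow> 'w \<Rightarrow> nat list"
  assumes "d \<ge> 1" and "a > 0" and "orrw d a M X"
  shows "(a > log 2 (real d) \<longrightarrow> as_recurrent M X) \<and>
    (a < log 2 (real d) \<longrightarrow> as_transient d M X)"
proof -
  interpret orrw d a M X by fact
  have "log 2 (real d) < a \<longleftrightarrow> real d < 2 powr a" "a < log 2 (real d) \<longleftrightarrow> 2 powr a < real d"
    using assms(1) by (auto simp: log_less_iff less_log_iff)
  then show ?thesis using recurrent[OF assms(2,1)] transient[OF assms(2)] by blast
qed

end
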